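(* Let $\mathbf{k}$ be a field (algebraically closed of characteristic $0$). For every $n\ge1$, the following identity holds in the group algebra $\mathbf{k}\mathbb{B}_{n+1}$ of the braid group: $$\mathbf{S}^{n+1}(e-U^n_1)(e-U^n_2)\cdots(e-U^n_n)=R^n_1\,\mathbf{S}^{n|1}.$$
   Context: $\mathbb{B}_n$ is the braid group with generators $\sigma_1,\dots,\sigma_{n-1}$ and relations $\sigma_i\sigma_j=\sigma_j\sigma_i$ if $|i-j|>1$, $\sigma_i\sigma_{i+1}\sigma_i=\sigma_{i+1}\sigma_i\sigma_{i+1}$; $e$ is its identity element. $\mathbb{B}_n$ is viewed inside $\mathbb{B}_{n+1}$ via $\sigma_i\mapsto\sigma_i$. For $1\le i\le j$ define $$U^j_i=\sigma_j\sigma_{j-1}\cdots\sigma_i,\qquad D^j_i=\sigma_i\sigma_{i+1}\cdots\sigma_j,$$ $$R^j_i=(e-\sigma_j\sigma_j)(e-D^j_{j-1}\sigma_j)(e-D^j_{j-2}\sigma_j)\cdots(e-D^j_i\sigma_j)$$ (elements of the group algebra $\mathbf{k}\mathbb{B}_{j+1}$; in particular $R^j_j=e-\sigma_j\sigma_j$). $\mathbb{S}_n$ is the symmetric group with generators $\tau_i=(i\ i{+}1)$, and $s:\mathbb{S}_n\to\mathbb{B}_n$ is the set-theoretic section of the projection $\sigma_i\mapsto\tau_i$ such that $s(\tau_{i_1}\cdots\tau_{i_l})=\sigma_{i_1}\cdots\sigma_{i_l}$ for every reduced expression. Put $\mathbf{S}^n=\sum_{x\in\mathbb{S}_n}s(x)\in\mathbf{k}\mathbb{B}_n$.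 The element $\mathbf{S}^{n|1}\in\mathbf{k}\mathbb{B}_{n+1}$ is the image of $\mathbf{S}^n$ under the inclusion $\mathbf{k}\mathbb{B}_n\hookrightarrow\mathbf{k}\mathbb{B}_{n+1}$, $\sigma_i\mapsto\sigma_i$. *)

theory Defs
  imports
    "HOL-Algebra.Sym_Groups"
    "HOL-Algebra.Ring"
    "HOL-Library.Poly_Mapping"
    "HOL-Computational_Algebra.Polynomial"
begin

text \<open>Products in a (noncommutative) monoid are ordered, hence indexed by lists.\<close>

definition list_prod :: "('a, 'm) monoid_scheme \<Rightarrow> 'a list \<Rightarrow> 'a" where
  "list_prod G xs = foldr (\<otimes>\<^bsub>G\<^esub>) xs \<one>\<^bsub>G\<^esub>"

lemma (in monoid) list_prod_closed:
  "set xs \<subseteq> carrier G \<Longrightarrow> list_prod G xs \<in> carrier G"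
  by (induction xs) (auto simp: list_prod_def)


section \<open>Braid groups\<close>

text \<open>
  The letter \<open>(i, True)\<close> stands for the generator \<open>\<sigma>\<^sub>i\<close>, the letter \<open>(i, False)\<close> for its
  inverse. The braid group on \<open>n\<close> strands is the set of words in these letters
  with \<open>1 \<le> i < n\<close>, modulo the congruence generated by the braid relations and by free cancellation.
\<close>

type_synonym braid_word = "(nat \<times> bool) list"

definition braid_words :: "nat \<Rightarrow> braid_word set" where
  "braid_words n = lists ({1..<n} \<times> UNIV)"

inductive braid_eq :: "nat \<Rightarrow> braid_word \<Rightarrow> braid_word \<Rightarrow> bool" for n where
  refl: "w \<in> braid_words n \<Longrightarrow> braid_eq n w w"
| sym: "braid_eq n u v \<Longrightarrow> braid_eq n v u"
| trans: "braid_eq n u v \<Longrightarrow> braid_eq n v w \<Longrightarrow> braid_eq n u w"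
| append: "braid_eq n u u' \<Longrightarrow> braid_eq n v v' \<Longrightarrow> braid_eq n (u @ v) (u' @ v')"
| cancel: "i \<in> {1..<n} \<Longrightarrow> braid_eq n [(i, b), (i, \<not> b)] []"
| commute: "i \<in> {1..<n} \<Longrightarrow> j \<in> {1..<n} \<Longrightarrow> \<bar>int i - int j\<bar> > 1 \<Longrightarrow>
    braid_eq n [(i, True), (j, True)] [(j, True), (i, True)]"
| braid: "i \<in> {1..<n} \<Longrightarrow> Suc i \<in> {1..<n} \<Longrightarrow>
    braid_eq n [(i, True), (Suc i, True), (i, True)] [(Suc i, True), (i, True), (Suc i, True)]"

definition braid_rel :: "nat \<Rightarrow> (braid_word \<times> braid_word) set" where
  "braid_rel n = {(u, v). braid_eq n u v}"

type_synonym braid = "braid_word set"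

definition braid_group :: "nat \<Rightarrow> braid monoid" where
  "braid_group n = \<lparr>
     carrier = braid_words n // braid_rel n,
     mult = (\<lambda>X Y. \<Union>u\<in>X. \<Union>v\<in>Y. braid_rel n `` {u @ v}),
     one = braid_rel n `` {[]} \<rparr>"

definition braid_gen :: "nat \<Rightarrow> nat \<Rightarrow> braid" where
  "braid_gen n i = braid_rel n `` {[(i, True)]}"

definition braid_incl :: "nat \<Rightarrow> braid \<Rightarrow> braid" where
  "braid_incl n X = (\<Union>w\<in>X. braid_rel (Suc n) `` {w})"

lemma braid_eq_words:
  "braid_eq n u v \<Longrightarrow> u \<in> braid_words n \<and> v \<in> braid_words n"
  by (induction rule: braid_eq.induct) (auto simp: braid_words_def)

lemma equiv_braid_rel: "equiv (braid_words n) (braid_rel n)"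
  by (auto simp: equiv_def refl_on_def sym_def trans_def braid_rel_def
      intro: braid_eq.refl braid_eq.sym braid_eq.trans dest: braid_eq_words)

lemma braid_class_eq_iff:
  assumes "u \<in> braid_words n" "v \<in> braid_words n"
  shows "braid_rel n `` {u} = braid_rel n `` {v} \<longleftrightarrow> braid_eq n u v"
  using eq_equiv_class_iff[OF equiv_braid_rel assms] by (simp add: braid_rel_def)

lemma braid_group_carrierE:
  assumes "X \<in> carrier (braid_group n)"
  obtains w where "w \<in> braid_words n" "X = braid_rel n `` {w}"
  using assms by (auto simp: braid_group_def elim: quotientE)

lemma braid_class_closed:
  "w \<in> braid_words n \<Longrightarrow> braid_rel n `` {w} \<in> carrier (braid_group n)"
  by (simp add: braid_group_def quotientI)

lemma braid_class_mult:
  assumes "u \<in> braid_words n" "v \<in> braid_words n"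
  shows "braid_rel n `` {u} \<otimes>\<^bsub>braid_group n\<^esub> braid_rel n `` {v} = braid_rel n `` {u @ v}"
proof -
  have "(\<lambda>u v. braid_rel n `` {u @ v}) respects2 braid_rel n"
    by (rule congruent2I')
      (metis braid_class_eq_iff braid_eq.append braid_eq_words braid_rel_def case_prodD mem_Collect_eq)
  from UN_equiv_class2[OF equiv_braid_rel equiv_braid_rel this assms] show ?thesis
    by (simp add: braid_group_def)
qed

lemma braid_append_words:
  "u \<in> braid_words n \<Longrightarrow> v \<in> braid_words n \<Longrightarrow> u @ v \<in> braid_words n"
  by (auto simp: braid_words_def)

lemma braid_nil_words: "[] \<in> braid_words n"
  by (simp add: braid_words_def)

lemma braid_word_left_inverse:
  "w \<in> braid_words n \<Longrightarrow> \<exists>v\<in>braid_words n. braid_eq n (v @ w) []"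
proof (induction w)
  case Nil
  then show ?case by (auto intro: braid_eq.refl)
next
  case (Cons x w)
  obtain i b where x: "x = (i, b)" by (cases x)
  have i: "i \<in> {1..<n}" and w: "w \<in> braid_words n"
    using Cons.prems by (auto simp: braid_words_def x)
  obtain v where v: "v \<in> braid_words n" "braid_eq n (v @ w) []"
    using Cons.IH w by blast
  have "braid_eq n [(i, \<not> b), (i, b)] []"
    using braid_eq.cancel[OF i, of "\<not> b"] by simp
  from braid_eq.append[OF braid_eq.refl[OF v(1)] braid_eq.append[OF this braid_eq.refl[OF w]]]
  have "braid_eq n (v @ [(i, \<not> b)] @ x # w) (v @ w)" by (simp add: x)
  with v(2) have "braid_eq n ((v @ [(i, \<not> b)]) @ x # w) []"
    by (auto intro: braid_eq.trans)
  moreover have "v @ [(i, \<not> b)] \<in> braid_words n"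
    using v(1) i by (auto simp: braid_words_def)
  ultimately show ?case by blast
qed

lemma group_braid_group: "group (braid_group n)"
proof (rule groupI)
  have one: "\<one>\<^bsub>braid_group n\<^esub> = braid_rel n `` {[]}"
    by (simp add: braid_group_def)
  note simps = braid_class_mult braid_append_words braid_class_closed braid_nil_words one
  show "\<one>\<^bsub>braid_group n\<^esub> \<in> carrier (braid_group n)"
    by (simp add: simps)
  show "X \<otimes>\<^bsub>braid_group n\<^esub> Y \<in> carrier (braid_group n)"
    if "X \<in> carrier (braid_group n)" "Y \<in> carrier (braid_group n)" for X Y
    using that by (auto elim!: braid_group_carrierE simp: simps)
  show "X \<otimes>\<^bsub>braid_group n\<^esub> Y \<otimes>\<^bsub>braid_group n\<^esub> Z = X \<otimes>\<^bsub>braid_group n\<^esub> (Y \<otimes>\<^bsub>braid_group n\<^esub> Z)"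
    if "X \<in> carrier (braid_group n)" "Y \<in> carrier (braid_group n)" "Z \<in> carrier (braid_group n)"
    for X Y Z
    using that by (auto elim!: braid_group_carrierE simp: simps)
  show "\<one>\<^bsub>braid_group n\<^esub> \<otimes>\<^bsub>braid_group n\<^esub> X = X" if "X \<in> carrier (braid_group n)" for X
    using that by (auto elim!: braid_group_carrierE simp: simps)
  show "\<exists>Y\<in>carrier (braid_group n). Y \<otimes>\<^bsub>braid_group n\<^esub> X = \<one>\<^bsub>braid_group n\<^esub>"
    if X: "X \<in> carrier (braid_group n)" for X
  proof -
    obtain w where w: "w \<in> braid_words n" "X = braid_rel n `` {w}"
      using X by (elim braid_group_carrierE)
    obtain v where v: "v \<in> braid_words n" "braid_eq n (v @ w) []"
      using braid_word_left_inverse[OF w(1)] by blast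
    then have "braid_rel n `` {v} \<otimes>\<^bsub>braid_group n\<^esub> X = \<one>\<^bsub>braid_group n\<^esub>"
      using w by (simp add: simps braid_class_eq_iff)
    with v(1) show ?thesis by (blast intro: braid_class_closed)
  qed
qed

lemma braid_gen_closed: "i \<in> {1..<n} \<Longrightarrow> braid_gen n i \<in> carrier (braid_group n)"
  unfolding braid_gen_def by (rule braid_class_closed) (auto simp: braid_words_def)

lemma braid_words_Suc: "w \<in> braid_words n \<Longrightarrow> w \<in> braid_words (Suc n)"
  by (auto simp: braid_words_def)

lemma braid_eq_Suc: "braid_eq n u v \<Longrightarrow> braid_eq (Suc n) u v"
proof (induction rule: braid_eq.induct)
  case (trans u v w)
  then show ?case by (blast intro: braid_eq.trans)
qed (auto intro: braid_eq.intros braid_words_Suc)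

lemma braid_incl_class:
  assumes "w \<in> braid_words n"
  shows "braid_incl n (braid_rel n `` {w}) = braid_rel (Suc n) `` {w}"
proof -
  have "(\<lambda>w. braid_rel (Suc n) `` {w}) respects braid_rel n"
    by (rule congruentI)
      (metis braid_class_eq_iff braid_eq_Suc braid_eq_words braid_rel_def case_prodD mem_Collect_eq)
  from UN_equiv_class[OF equiv_braid_rel this assms] show ?thesis
    by (simp add: braid_incl_def)
qed

lemma braid_incl_gen: "i \<in> {1..<n} \<Longrightarrow> braid_incl n (braid_gen n i) = braid_gen (Suc n) i"
  unfolding braid_gen_def by (rule braid_incl_class) (auto simp: braid_words_def)

lemma braid_incl_hom: "braid_incl n \<in> hom (braid_group n) (braid_group (Suc n))"
  by (rule homI)
    (auto elim!: braid_group_carrierE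
      simp: braid_incl_class braid_class_closed braid_words_Suc braid_class_mult braid_append_words)


section \<open>Group algebras\<close>

text \<open>
  The elements are the finitely supported functions on the group; multiplication is the bilinear
  extension of the group multiplication. The type class ring structure on \<^typ>\<open>'g \<Rightarrow>\<^sub>0 'k\<close> does
  not apply, as the group is given by a record rather than by the type \<^typ>\<open>'g\<close>.
\<close>

definition group_algebra ::
    "('g, 'm) monoid_scheme \<Rightarrow> ('g \<Rightarrow>\<^sub>0 'k::field) ring" where
  "group_algebra G = \<lparr>
     carrier = {f. Poly_Mapping.keys f \<subseteq> carrier G},
     mult = (\<lambda>f g. \<Sum>a\<in>Poly_Mapping.keys f. \<Sum>b\<in>Poly_Mapping.keys g.
       Poly_Mapping.single (a \<otimes>\<^bsub>G\<^esub> b) (Poly_Mapping.lookup f a * Poly_Mapping.lookup g b)),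
     one = Poly_Mapping.single \<one>\<^bsub>G\<^esub> 1,
     zero = 0,
     add = (+) \<rparr>"

definition group_elt :: "'g \<Rightarrow> ('g \<Rightarrow>\<^sub>0 'k::field)" where
  "group_elt x = Poly_Mapping.single x 1"

definition group_algebra_map :: "('g \<Rightarrow> 'h) \<Rightarrow> ('g \<Rightarrow>\<^sub>0 'k::field) \<Rightarrow> ('h \<Rightarrow>\<^sub>0 'k)" where
  "group_algebra_map \<phi> f =
     (\<Sum>a\<in>Poly_Mapping.keys f. Poly_Mapping.single (\<phi> a) (Poly_Mapping.lookup f a))"

lemma group_algebra_map_superset:
  assumes "finite A" "Poly_Mapping.keys f \<subseteq> A"
  shows "group_algebra_map \<phi> f = (\<Sum>a\<in>A. Poly_Mapping.single (\<phi> a) (Poly_Mapping.lookup f a))"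
  unfolding group_algebra_map_def
  by (rule sum.mono_neutral_left) (use assms in \<open>auto simp: in_keys_iff\<close>)

lemma group_algebra_map_elt [simp]: "group_algebra_map \<phi> (group_elt x) = group_elt (\<phi> x)"
  by (simp add: group_algebra_map_def group_elt_def)

lemma group_algebra_mult_superset:
  assumes "finite A" "Poly_Mapping.keys f \<subseteq> A" "finite B" "Poly_Mapping.keys g \<subseteq> B"
  shows "f \<otimes>\<^bsub>group_algebra G\<^esub> g = (\<Sum>a\<in>A. \<Sum>b\<in>B.
    Poly_Mapping.single (a \<otimes>\<^bsub>G\<^esub> b) (Poly_Mapping.lookup f a * Poly_Mapping.lookup g b))"
proof -
  have "f \<otimes>\<^bsub>group_algebra G\<^esub> g = (\<Sum>a\<in>Poly_Mapping.keys f. \<Sum>b\<in>B.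
      Poly_Mapping.single (a \<otimes>\<^bsub>G\<^esub> b) (Poly_Mapping.lookup f a * Poly_Mapping.lookup g b))"
    unfolding group_algebra_def monoid.simps
    by (intro sum.cong refl sum.mono_neutral_left) (use assms in \<open>auto simp: in_keys_iff\<close>)
  also have "\<dots> = (\<Sum>a\<in>A. \<Sum>b\<in>B.
      Poly_Mapping.single (a \<otimes>\<^bsub>G\<^esub> b) (Poly_Mapping.lookup f a * Poly_Mapping.lookup g b))"
    by (rule sum.mono_neutral_left) (use assms in \<open>auto simp: in_keys_iff\<close>)
  finally show ?thesis .
qed

lemma group_algebra_distrib_right:
  "(f + g) \<otimes>\<^bsub>group_algebra G\<^esub> h = f \<otimes>\<^bsub>group_algebra G\<^esub> h + g \<otimes>\<^bsub>group_algebra G\<^esub> h"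
proof -
  let ?A = "Poly_Mapping.keys f \<union> Poly_Mapping.keys g" and ?B = "Poly_Mapping.keys h"
  have "Poly_Mapping.keys (f + g) \<subseteq> ?A" by (rule Poly_Mapping.keys_add)
  then show ?thesis
    by (simp add: group_algebra_mult_superset[where A = ?A and B = ?B]
        lookup_add distrib_right single_add sum.distrib)
qed

lemma group_algebra_distrib_left:
  "h \<otimes>\<^bsub>group_algebra G\<^esub> (f + g) = h \<otimes>\<^bsub>group_algebra G\<^esub> f + h \<otimes>\<^bsub>group_algebra G\<^esub> g"
proof -
  let ?A = "Poly_Mapping.keys f \<union> Poly_Mapping.keys g" and ?B = "Poly_Mapping.keys h"
  have "Poly_Mapping.keys (f + g) \<subseteq> ?A" by (rule Poly_Mapping.keys_add)
  then show ?thesis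
    by (simp add: group_algebra_mult_superset[where A = ?B and B = ?A]
        lookup_add distrib_left single_add sum.distrib)
qed

lemma group_algebra_mult_zero:
  "0 \<otimes>\<^bsub>group_algebra G\<^esub> f = 0" "f \<otimes>\<^bsub>group_algebra G\<^esub> 0 = 0"
  by (simp_all add: group_algebra_def)

lemma group_algebra_mult_single:
  "Poly_Mapping.single a c \<otimes>\<^bsub>group_algebra G\<^esub> Poly_Mapping.single b d =
     Poly_Mapping.single (a \<otimes>\<^bsub>G\<^esub> b) (c * d)"
  by (subst group_algebra_mult_superset[where A = "{a}" and B = "{b}"]) auto

lemma group_algebra_induct [consumes 1, case_names zero single add]:
  fixes P :: "('g \<Rightarrow>\<^sub>0 'k::field) \<Rightarrow> bool"
  assumes f: "f \<in> carrier (group_algebra G)"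
    and zero: "P 0"
    and single: "\<And>a c. a \<in> carrier G \<Longrightarrow> P (Poly_Mapping.single a c)"
    and add: "\<And>f g. P f \<Longrightarrow> P g \<Longrightarrow> P (f + g)"
  shows "P f"
proof -
  have *: "P (\<Sum>a\<in>A. Poly_Mapping.single a (Poly_Mapping.lookup f a))" if "A \<subseteq> carrier G" for A
    using that
    by (induction A rule: infinite_finite_induct) (auto intro: zero single add)
  have "(\<Sum>a\<in>Poly_Mapping.keys f. Poly_Mapping.single a (Poly_Mapping.lookup f a)) = f"
    by (rule poly_mapping_eqI)
      (simp add: lookup_sum lookup_single when_def sum.delta in_keys_iff)
  with *[of "Poly_Mapping.keys f"] f show ?thesis
    by (simp add: group_algebra_def)
qed

lemma ring_group_algebra:
  assumes "group G"
  shows "ring (group_algebra G :: ('g \<Rightarrow>\<^sub>0 'k::field) ring)"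
proof -
  interpret G: group G by fact
  let ?A = "group_algebra G :: ('g \<Rightarrow>\<^sub>0 'k) ring"
  have [simp]: "carrier ?A = {f. Poly_Mapping.keys f \<subseteq> carrier G}"
    and [simp]: "\<zero>\<^bsub>?A\<^esub> = 0" and [simp]: "\<And>f g. f \<oplus>\<^bsub>?A\<^esub> g = f + g"
    and one: "\<one>\<^bsub>?A\<^esub> = Poly_Mapping.single \<one>\<^bsub>G\<^esub> 1"
    by (simp_all add: group_algebra_def)
  have ab: "abelian_group ?A"
  proof (rule abelian_groupI)
    fix f g assume "f \<in> carrier ?A" "g \<in> carrier ?A"
    then show "f \<oplus>\<^bsub>?A\<^esub> g \<in> carrier ?A"
      using Poly_Mapping.keys_add[of f g] by auto
  next
    fix f assume "f \<in> carrier ?A"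
    then show "\<exists>g\<in>carrier ?A. g \<oplus>\<^bsub>?A\<^esub> f = \<zero>\<^bsub>?A\<^esub>"
      by (intro bexI[of _ "- f"]) auto
  qed (simp_all add: add.assoc add.commute)
  have closed: "f \<otimes>\<^bsub>?A\<^esub> g \<in> carrier ?A" if f: "f \<in> carrier ?A" and g: "g \<in> carrier ?A" for f g
    using f
  proof (induction rule: group_algebra_induct)
    case (single a c)
    note a = single
    from g show ?case
    proof (induction rule: group_algebra_induct)
      case (add h k)
      then show ?case
        using Poly_Mapping.keys_add[of "Poly_Mapping.single a c \<otimes>\<^bsub>?A\<^esub> h" "Poly_Mapping.single a c \<otimes>\<^bsub>?A\<^esub> k"]
        by (auto simp: group_algebra_distrib_left)
    qed (use a in \<open>auto simp: group_algebra_mult_zero group_algebra_mult_single\<close>)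
  next
    case (add h k)
    then show ?case
      using Poly_Mapping.keys_add[of "h \<otimes>\<^bsub>?A\<^esub> g" "k \<otimes>\<^bsub>?A\<^esub> g"]
      by (auto simp: group_algebra_distrib_right)
  qed (simp add: group_algebra_mult_zero)
  have assoc: "f \<otimes>\<^bsub>?A\<^esub> g \<otimes>\<^bsub>?A\<^esub> h = f \<otimes>\<^bsub>?A\<^esub> (g \<otimes>\<^bsub>?A\<^esub> h)"
    if f: "f \<in> carrier ?A" and g: "g \<in> carrier ?A" and h: "h \<in> carrier ?A" for f g h
    using f
  proof (induction rule: group_algebra_induct)
    case (single a c)
    note a = single
    from g show ?case
    proof (induction rule: group_algebra_induct)
      case (single b d)
      note b = single
      from h show ?case
        by (induction rule: group_algebra_induct)
          (use a b in \<open>auto simp: group_algebra_mult_zero group_algebra_mult_single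
             group_algebra_distrib_left G.m_assoc mult.assoc\<close>)
    qed (simp_all add: group_algebra_mult_zero group_algebra_distrib_left group_algebra_distrib_right)
  qed (simp_all add: group_algebra_mult_zero group_algebra_distrib_right)
  have mon: "monoid ?A"
  proof (rule monoidI)
    show "\<one>\<^bsub>?A\<^esub> \<in> carrier ?A" by (simp add: one)
    fix f assume f: "f \<in> carrier ?A"
    show "\<one>\<^bsub>?A\<^esub> \<otimes>\<^bsub>?A\<^esub> f = f"
      using f by (induction rule: group_algebra_induct)
        (auto simp: one group_algebra_mult_zero group_algebra_mult_single group_algebra_distrib_left)
    show "f \<otimes>\<^bsub>?A\<^esub> \<one>\<^bsub>?A\<^esub> = f"
      using f by (induction rule: group_algebra_induct)
        (auto simp: one group_algebra_mult_zero group_algebra_mult_single group_algebra_distrib_right)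
  qed (use closed assoc in blast)+
  show ?thesis
    by (rule ringI[OF ab mon])
      (simp_all add: group_algebra_distrib_left group_algebra_distrib_right)
qed

abbreviation braid_algebra :: "nat \<Rightarrow> (braid \<Rightarrow>\<^sub>0 'k::field) ring" where
  "braid_algebra n \<equiv> group_algebra (braid_group n)"


section \<open>The section from the symmetric group and the symmetrizer\<close>

text \<open>Products of permutations are compositions of maps, as in \<^const>\<open>sym_group\<close>.\<close>

definition reduced_expression :: "nat \<Rightarrow> nat list \<Rightarrow> (nat \<Rightarrow> nat) \<Rightarrow> bool" where
  "reduced_expression n js x \<longleftrightarrow>
     js \<in> lists {1..<n} \<and>
     list_prod (sym_group n) (map (\<lambda>i. Transposition.transpose i (Suc i)) js) = x \<and>
     (\<forall>ks\<in>lists {1..<n}.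
        list_prod (sym_group n) (map (\<lambda>i. Transposition.transpose i (Suc i)) ks) = x \<longrightarrow> length js \<le> length ks)"

text \<open>
  Every permutation has a reduced expression, so at most one braid satisfies the condition below;
  that there is one is Matsumoto's theorem.
\<close>

definition braid_section :: "nat \<Rightarrow> (nat \<Rightarrow> nat) \<Rightarrow> braid" where
  "braid_section n x = (THE b. \<forall>js. reduced_expression n js x \<longrightarrow>
     b = list_prod (braid_group n) (map (braid_gen n) js))"

definition symmetrizer :: "nat \<Rightarrow> (braid \<Rightarrow>\<^sub>0 'k::field)" where
  "symmetrizer n = (\<Oplus>\<^bsub>braid_algebra n\<^esub>x\<in>carrier (sym_group n). group_elt (braid_section n x))"

definition symmetrizer_incl :: "nat \<Rightarrow> (braid \<Rightarrow>\<^sub>0 'k::field)" where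
  "symmetrizer_incl n = group_algebra_map (braid_incl n) (symmetrizer n)"


section \<open>The elements U, D and R\<close>

text \<open>For \<open>1 \<le> i \<le> j\<close>, the elements \<open>U\<close> and \<open>D\<close> are taken in the braid group on \<open>j + 1\<close> strands.\<close>

definition braid_U :: "nat \<Rightarrow> nat \<Rightarrow> braid" where
  "braid_U j i = list_prod (braid_group (Suc j)) (map (braid_gen (Suc j)) (rev [i..<Suc j]))"

definition braid_D :: "nat \<Rightarrow> nat \<Rightarrow> braid" where
  "braid_D j i = list_prod (braid_group (Suc j)) (map (braid_gen (Suc j)) [i..<Suc j])"

definition one_minus :: "nat \<Rightarrow> braid \<Rightarrow> (braid \<Rightarrow>\<^sub>0 'k::field)" where
  "one_minus n b = \<one>\<^bsub>braid_algebra n\<^esub> \<ominus>\<^bsub>braid_algebra n\<^esub> group_elt b"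

definition braid_R :: "nat \<Rightarrow> nat \<Rightarrow> (braid \<Rightarrow>\<^sub>0 'k::field)" where
  "braid_R j i =
     one_minus (Suc j) (braid_gen (Suc j) j \<otimes>\<^bsub>braid_group (Suc j)\<^esub> braid_gen (Suc j) j)
     \<otimes>\<^bsub>braid_algebra (Suc j)\<^esub>
     list_prod (braid_algebra (Suc j))
       (map (\<lambda>k. one_minus (Suc j) (braid_D j k \<otimes>\<^bsub>braid_group (Suc j)\<^esub> braid_gen (Suc j) j))
         (rev [i..<j]))"

end

theory Submission
  imports Defs
begin

text \<open>
  Every permutation of \<open>n + 1\<close> points is, in exactly one way and with lengths adding up, a permutation
  of the first \<open>n\<close> points followed by a cycle \<open>\<tau>\<^sub>n \<dots> \<tau>\<^sub>j\<close>. Hence the symmetrizer on \<open>n + 1\<close> strands is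
  \<open>S T\<close> with \<open>S\<close> the symmetrizer on \<open>n\<close> strands and \<open>T = e + U\<^sup>n\<^sub>n + \<dots> + U\<^sup>n\<^sub>1\<close>. The braid \<open>U\<^sup>n\<^sub>1\<close>
  conjugates \<open>\<sigma>\<^sub>i\<^sub>+\<^sub>1\<close> to \<open>\<sigma>\<^sub>i\<close>, so multiplying \<open>T\<close> by \<open>e - U\<^sup>n\<^sub>1\<close> gives \<open>e - \<sigma>\<^sub>n U\<^sup>n\<^sub>1\<close> times the same sum
  without its last term, and the product telescopes (\<open>sum_U_telescope\<close>): the left hand side of
  the identity is \<open>S\<close> times the product of the \<open>e - \<sigma>\<^sub>n U\<^sup>n\<^sub>i\<close>.

  Put \<open>y = - \<sigma>\<^sub>n\<^sup>2\<close>. Then \<open>e - \<sigma>\<^sub>n U\<^sup>n\<^sub>i = e + y \<sigma>\<^sub>n\<^sub>-\<^sub>1 \<dots> \<sigma>\<^sub>i\<close>, the factors of \<open>R\<^sup>n\<^sub>1\<close> are the reversed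
  words \<open>e + \<sigma>\<^sub>i \<dots> \<sigma>\<^sub>n\<^sub>-\<^sub>1 y\<close> in reversed order, and \<open>y, \<sigma>\<^sub>n\<^sub>-\<^sub>1, \<dots>, \<sigma>\<^sub>1\<close> satisfy the braid relations of
  type B, since \<open>\<sigma>\<^sub>n\<^sub>-\<^sub>1 y \<sigma>\<^sub>n\<^sub>-\<^sub>1 y = y \<sigma>\<^sub>n\<^sub>-\<^sub>1 y \<sigma>\<^sub>n\<^sub>-\<^sub>1\<close>. What remains is that \<open>S\<close> times the product of the
  \<open>e + y \<sigma>\<^sub>n\<^sub>-\<^sub>1 \<dots> \<sigma>\<^sub>i\<close> is unchanged when all words are reversed. The reason is that this element is
  the type B symmetrizer: the sum of the positive lifts of all elements of the hyperoctahedral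
  group, factored along the symmetric subgroup; and inversion permutes that group.

  The proof of this invariance avoids the hyperoctahedral group. Peeling off one strand at a time
  factors the same element as a product of coset sums (\<open>coset_B\<close>) \<open>V\<^sub>n V\<^sub>n\<^sub>-\<^sub>1 \<dots> V\<^sub>1\<close>
  (\<open>symm_prod_B_eq_symm_B\<close>), where \<open>V\<^sub>k = e + \<sigma>\<^sub>k V\<^sub>k\<^sub>+\<^sub>1 + z\<^sub>k\<close> and \<open>z\<^sub>k\<close> commutes with everything that
  occurs in \<open>V\<^sub>n, \<dots>, V\<^sub>k\<^sub>+\<^sub>1\<close>. Any product of this shape equals its reversal (\<open>palindromic\<close>). Reversal
  of words is expressed by passing to the opposite ring.

  The section of the symmetric group is accessible through canonical words, the products of
  cycles \<open>\<sigma>\<^sub>m \<dots> \<sigma>\<^sub>j\<close> described above: every reduced word can be rewritten into a canonical one by braid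
  relations (\<open>matsumoto\<close>), and canonical words biject with permutations.
\<close>

section \<open>Ordered products\<close>

lemma list_prod_Nil [simp]: "list_prod G [] = \<one>\<^bsub>G\<^esub>"
  by (simp add: list_prod_def)

lemma list_prod_Cons [simp]: "list_prod G (x # xs) = x \<otimes>\<^bsub>G\<^esub> list_prod G xs"
  by (simp add: list_prod_def)

lemma (in monoid) list_prod_append:
  "set xs \<subseteq> carrier G \<Longrightarrow> set ys \<subseteq> carrier G \<Longrightarrow>
    list_prod G (xs @ ys) = list_prod G xs \<otimes> list_prod G ys"
  by (induction xs) (auto simp: m_assoc list_prod_closed)

lemma (in monoid) list_prod_commute:
  assumes "x \<in> carrier G" "set ys \<subseteq> carrier G" "\<And>y. y \<in> set ys \<Longrightarrow> x \<otimes> y = y \<otimes> x"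
  shows "x \<otimes> list_prod G ys = list_prod G ys \<otimes> x"
  using assms(2,3)
proof (induction ys)
  case (Cons y ys)
  have "x \<otimes> (y \<otimes> list_prod G ys) = y \<otimes> (x \<otimes> list_prod G ys)"
    using Cons.prems assms(1) by (simp add: list_prod_closed flip: m_assoc)
  also have "\<dots> = y \<otimes> (list_prod G ys \<otimes> x)"
    using Cons by simp
  finally show ?case
    using Cons.prems assms(1) by (simp add: list_prod_closed m_assoc)
qed (use assms(1) in simp)

lemma (in ring) finsum_commute:
  assumes "finite I" "x \<in> carrier R" "f \<in> I \<rightarrow> carrier R" "\<And>i. i \<in> I \<Longrightarrow> x \<otimes> f i = f i \<otimes> x"
  shows "x \<otimes> finsum R f I = finsum R f I \<otimes> x"
proof -
  have "x \<otimes> finsum R f I = (\<Oplus>i\<in>I. x \<otimes> f i)"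
    using assms by (intro finsum_rdistr) auto
  also have "\<dots> = (\<Oplus>i\<in>I. f i \<otimes> x)"
    using assms by (intro finsum_cong') auto
  also have "\<dots> = finsum R f I \<otimes> x"
    using assms by (intro finsum_ldistr[symmetric]) auto
  finally show ?thesis .
qed


section \<open>Braid relations in a monoid\<close>

text \<open>
  The elements \<open>g i\<close> and their commutation are demanded for all indices, so that no closure
  condition depends on a range; a family given for \<open>1 \<le> i < N\<close> can be continued by the unit, which
  commutes with everything and falsifies the braid relation only at the ends of the range. Taking a
  monoid instead of a group makes the permutations and the ring elements instances of the same
  locale.
\<close>

locale braid_monoid = monoid G for G :: "('a, 'm) monoid_scheme" (structure) +
  fixes g :: "nat \<Rightarrow> 'a" and N :: nat
  assumes gen_closed [simp, intro]: "g i \<in> carrier G"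
    and gen_commute: "Suc i < j \<Longrightarrow> g i \<otimes> g j = g j \<otimes> g i"
    and gen_braid: "1 \<le> i \<Longrightarrow> Suc i < N \<Longrightarrow> g i \<otimes> g (Suc i) \<otimes> g i = g (Suc i) \<otimes> g i \<otimes> g (Suc i)"
begin

definition word :: "nat list \<Rightarrow> 'a" where
  "word w = list_prod G (map g w)"

text \<open>
  Upper bounds are exclusive: with \<open>g i = \<sigma>\<^sub>i\<close>, the braid \<open>D\<^sup>m\<^sub>k\<close> is \<open>D k (Suc m)\<close>, and \<open>D k k\<close> is
  the empty product, likewise for \<open>U\<close>. Thus \<open>D k m\<close> and \<open>U k m\<close> live on the strands \<open>k, \<dots>, m\<close>.
\<close>

definition D :: "nat \<Rightarrow> nat \<Rightarrow> 'a" where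
  "D k m = word [k..<m]"

definition U :: "nat \<Rightarrow> nat \<Rightarrow> 'a" where
  "U k m = word (rev [k..<m])"

lemma word_closed [simp, intro]: "word w \<in> carrier G"
  unfolding word_def by (rule list_prod_closed) auto

lemma word_Nil [simp]: "word [] = \<one>"
  and word_Cons: "word (i # w) = g i \<otimes> word w"
  and word_append: "word (v @ w) = word v \<otimes> word w"
  unfolding word_def by (simp_all, rule list_prod_append) auto

lemma word_commute:
  assumes "x \<in> carrier G" "\<And>i. i \<in> set w \<Longrightarrow> x \<otimes> g i = g i \<otimes> x"
  shows "x \<otimes> word w = word w \<otimes> x"
  unfolding word_def using assms by (intro list_prod_commute) auto

lemma D_closed [simp, intro]: "D k m \<in> carrier G"
  and U_closed [simp, intro]: "U k m \<in> carrier G"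
  by (simp_all add: D_def U_def)

lemma D_refl [simp]: "D k k = \<one>"
  and U_refl [simp]: "U k k = \<one>"
  by (simp_all add: D_def U_def)

lemma D_Cons: "k < m \<Longrightarrow> D k m = g k \<otimes> D (Suc k) m"
  and D_snoc: "k \<le> m \<Longrightarrow> D k (Suc m) = D k m \<otimes> g m"
  and U_Cons: "k \<le> m \<Longrightarrow> U k (Suc m) = g m \<otimes> U k m"
  and U_snoc: "k < m \<Longrightarrow> U k m = U (Suc k) m \<otimes> g k"
  by (simp_all add: D_def U_def word_append word_Cons upt_conv_Cons)

lemma D_split: "k \<le> j \<Longrightarrow> j \<le> m \<Longrightarrow> D k m = D k j \<otimes> D j m"
  and U_split: "k \<le> j \<Longrightarrow> j \<le> m \<Longrightarrow> U k m = U j m \<otimes> U k j"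
  using upt_add_eq_append[of k j "m - j"] by (simp_all add: D_def U_def word_append)

lemma commute_D:
  "x \<in> carrier G \<Longrightarrow> (\<And>i. k \<le> i \<Longrightarrow> i < m \<Longrightarrow> x \<otimes> g i = g i \<otimes> x) \<Longrightarrow> x \<otimes> D k m = D k m \<otimes> x"
  and commute_U:
  "x \<in> carrier G \<Longrightarrow> (\<And>i. k \<le> i \<Longrightarrow> i < m \<Longrightarrow> x \<otimes> g i = g i \<otimes> x) \<Longrightarrow> x \<otimes> U k m = U k m \<otimes> x"
  by (auto simp: D_def U_def intro!: word_commute)

text \<open>
  All factors of \<open>D k m\<close> but \<open>g i \<otimes> g (Suc i)\<close> commute with whatever has to pass them, and on these
  two the claim is the braid relation.
\<close>

lemma D_shift:
  assumes "1 \<le> k" "k \<le> i" "Suc i < m" "m \<le> N"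
  shows "D k m \<otimes> g i = g (Suc i) \<otimes> D k m"
proof -
  have split: "D k m = D k i \<otimes> (g i \<otimes> (g (Suc i) \<otimes> D (Suc (Suc i)) m))"
    using assms D_split[of k i m] D_Cons[of i m] D_Cons[of "Suc i" m] by simp
  have 1: "D (Suc (Suc i)) m \<otimes> g i = g i \<otimes> D (Suc (Suc i)) m"
    using gen_commute by (intro commute_D[symmetric]) auto
  have 2: "g (Suc i) \<otimes> D k i = D k i \<otimes> g (Suc i)"
    by (intro commute_D) (auto intro: gen_commute gen_commute[symmetric])
  have 3: "g i \<otimes> g (Suc i) \<otimes> g i = g (Suc i) \<otimes> g i \<otimes> g (Suc i)"
    using assms by (intro gen_braid) auto
  have "D k m \<otimes> g i = D k i \<otimes> (g i \<otimes> (g (Suc i) \<otimes> (D (Suc (Suc i)) m \<otimes> g i)))"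
    unfolding split by (simp add: m_assoc)
  also have "\<dots> = D k i \<otimes> ((g i \<otimes> g (Suc i) \<otimes> g i) \<otimes> D (Suc (Suc i)) m)"
    unfolding 1 by (simp add: m_assoc)
  also have "\<dots> = D k i \<otimes> g (Suc i) \<otimes> (g i \<otimes> (g (Suc i) \<otimes> D (Suc (Suc i)) m))"
    unfolding 3 by (simp add: m_assoc)
  also have "\<dots> = g (Suc i) \<otimes> D k m"
    unfolding split 2[symmetric] by (simp add: m_assoc)
  finally show ?thesis .
qed

lemma U_shift:
  assumes "1 \<le> k" "k \<le> i" "Suc i < m" "m \<le> N"
  shows "g i \<otimes> U k m = U k m \<otimes> g (Suc i)"
proof -
  have split: "U k m = U (Suc (Suc i)) m \<otimes> (g (Suc i) \<otimes> (g i \<otimes> U k i))"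
    using assms U_split[of k "Suc (Suc i)" m] by (simp add: U_Cons)
  have 1: "g i \<otimes> U (Suc (Suc i)) m = U (Suc (Suc i)) m \<otimes> g i"
    by (intro commute_U) (auto intro: gen_commute gen_commute[symmetric])
  have 2: "g (Suc i) \<otimes> U k i = U k i \<otimes> g (Suc i)"
    by (intro commute_U) (auto intro: gen_commute gen_commute[symmetric])
  have 3: "g i \<otimes> g (Suc i) \<otimes> g i = g (Suc i) \<otimes> g i \<otimes> g (Suc i)"
    using assms by (intro gen_braid) auto
  have "g i \<otimes> U k m = (g i \<otimes> U (Suc (Suc i)) m) \<otimes> (g (Suc i) \<otimes> (g i \<otimes> U k i))"
    unfolding split by (simp add: m_assoc)
  also have "\<dots> = U (Suc (Suc i)) m \<otimes> ((g i \<otimes> g (Suc i) \<otimes> g i) \<otimes> U k i)"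
    unfolding 1 by (simp add: m_assoc)
  also have "\<dots> = U (Suc (Suc i)) m \<otimes> (g (Suc i) \<otimes> (g i \<otimes> (g (Suc i) \<otimes> U k i)))"
    unfolding 3 by (simp add: m_assoc)
  also have "\<dots> = U k m \<otimes> g (Suc i)"
    unfolding split 2 by (simp add: m_assoc)
  finally show ?thesis .
qed

lemma U_shift_D:
  assumes "1 \<le> k" "k \<le> j" "Suc j \<le> m" "m \<le> N"
  shows "D k j \<otimes> U k m = U k m \<otimes> D (Suc k) (Suc j)"
  using assms(2,3)
proof (induction j rule: dec_induct)
  case (step j)
  have "D k (Suc j) \<otimes> U k m = D k j \<otimes> (g j \<otimes> U k m)"
    using step by (simp add: D_snoc m_assoc)
  also have "\<dots> = (D k j \<otimes> U k m) \<otimes> g (Suc j)"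
    using step.hyps step.prems assms by (simp add: U_shift m_assoc)
  also have "\<dots> = U k m \<otimes> (D (Suc k) (Suc j) \<otimes> g (Suc j))"
    using step by (simp flip: m_assoc)
  finally show ?case
    using step by (simp add: D_snoc)
qed simp

end

section \<open>Opposite rings\<close>

text \<open>
  Reversing words is an antiautomorphism of the braid algebra. For arbitrary rings with braid
  generators the same symmetry is the passage to the opposite ring, under which \<open>D\<close> and \<open>U\<close> trade
  places, so that every identity in the ring comes with its mirror image.
\<close>

definition opposite :: "('a, 'm) ring_scheme \<Rightarrow> ('a, 'm) ring_scheme" where
  "opposite R = R\<lparr>mult := \<lambda>x y. y \<otimes>\<^bsub>R\<^esub> x\<rparr>"

lemma opposite_simps [simp]:
  "carrier (opposite R) = carrier R"
  "x \<otimes>\<^bsub>opposite R\<^esub> y = y \<otimes>\<^bsub>R\<^esub> x"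
  "\<one>\<^bsub>opposite R\<^esub> = \<one>\<^bsub>R\<^esub>"
  "x \<oplus>\<^bsub>opposite R\<^esub> y = x \<oplus>\<^bsub>R\<^esub> y"
  "\<zero>\<^bsub>opposite R\<^esub> = \<zero>\<^bsub>R\<^esub>"
  by (simp_all add: opposite_def)

lemma (in ring) ring_opposite: "ring (opposite R)"
proof (rule ringI)
  show "abelian_group (opposite R)"
    by (rule abelian_groupI) (auto simp: a_ac intro: bexI[of _ "\<ominus> _"] l_neg)
  show "monoid (opposite R)"
    by (rule monoidI) (auto simp: m_assoc)
qed (auto simp: l_distr r_distr)

lemma (in ring) list_prod_opposite:
  "set xs \<subseteq> carrier R \<Longrightarrow> list_prod (opposite R) xs = list_prod R (rev xs)"
  by (induction xs) (auto simp: list_prod_append list_prod_closed)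

section \<open>Symmetrizers in a ring with braid generators\<close>

locale braid_ring = ring R + braid_monoid R g N
  for R :: "('a, 'm) ring_scheme" (structure) and g N
begin

text \<open>
  The sum of the lifts of the shortest representatives of the cosets \<open>H x\<close> in the group of
  permutations of \<open>k, \<dots>, m\<close>, where \<open>H\<close> fixes \<open>m\<close>; for \<open>sum_D\<close> below, \<open>H\<close> fixes \<open>k\<close> instead.
\<close>

definition sum_U :: "nat \<Rightarrow> nat \<Rightarrow> 'a" where
  "sum_U k m = (\<Oplus>j\<in>{k..m}. U j m)"

definition sum_D :: "nat \<Rightarrow> nat \<Rightarrow> 'a" where
  "sum_D k m = (\<Oplus>j\<in>{k..m}. D k j)"

text \<open>
  The symmetrizer on the strands \<open>k, \<dots>, m\<close>, built up by adding the last strand in each step.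
\<close>

definition symm :: "nat \<Rightarrow> nat \<Rightarrow> 'a" where
  "symm k m = list_prod R (map (sum_U k) [k..<Suc m])"

lemma sum_U_closed [simp, intro]: "sum_U k m \<in> carrier R"
  and sum_D_closed [simp, intro]: "sum_D k m \<in> carrier R"
  by (auto simp: sum_U_def sum_D_def)

lemma symm_closed [simp, intro]: "symm k m \<in> carrier R"
  unfolding symm_def by (rule list_prod_closed) auto

lemma sum_U_refl [simp]: "sum_U k k = \<one>"
  and sum_D_refl [simp]: "sum_D k k = \<one>"
  by (simp_all add: sum_U_def sum_D_def)

lemma sum_U_lower: "k < m \<Longrightarrow> sum_U k m = sum_U (Suc k) m \<oplus> U k m"
  and sum_D_upper: "k \<le> m \<Longrightarrow> sum_D k (Suc m) = sum_D k m \<oplus> D k (Suc m)"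
proof -
  assume "k < m"
  then have "{k..m} = insert k {Suc k..m}" by auto
  then show "sum_U k m = sum_U (Suc k) m \<oplus> U k m"
    by (simp add: sum_U_def a_comm)
next
  assume "k \<le> m"
  then have "{k..Suc m} = insert (Suc m) {k..m}" by auto
  then show "sum_D k (Suc m) = sum_D k m \<oplus> D k (Suc m)"
    by (simp add: sum_D_def a_comm)
qed

text \<open>
  The two summands here and in \<open>sum_D_lower\<close> belong to the two double cosets of \<open>H\<close>: that of
  the identity and that of a simple transposition.
\<close>

lemma sum_U_upper:
  assumes "k \<le> m"
  shows "sum_U k (Suc m) = \<one> \<oplus> g m \<otimes> sum_U k m"
  using assms
proof (induction k rule: inc_induct)
  case base
  show ?case by (simp add: sum_U_lower[of m "Suc m"] U_Cons)
next
  case (step k)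
  then show ?case
    by (simp add: sum_U_lower[of k "Suc m"] sum_U_lower[of k m] U_Cons r_distr a_assoc)
qed

lemma sum_D_lower:
  assumes "k < m"
  shows "sum_D k m = \<one> \<oplus> g k \<otimes> sum_D (Suc k) m"
  using Suc_leI[OF assms]
proof (induction m rule: dec_induct)
  case base
  show ?case by (simp add: sum_D_upper[of k k] D_Cons)
next
  case (step m)
  then show ?case
    by (simp add: sum_D_upper[of k m] sum_D_upper[of "Suc k" m] D_Cons[of k] r_distr a_assoc)
qed

lemma symm_refl [simp]: "symm k k = \<one>"
  and symm_empty: "m < k \<Longrightarrow> symm k m = \<one>"
  and symm_upper: "k \<le> Suc m \<Longrightarrow> symm k (Suc m) = symm k m \<otimes> sum_U k (Suc m)"
  by (auto simp: symm_def list_prod_append image_subset_iff)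

lemma commute_sum_U:
  assumes "x \<in> carrier R" "\<And>i. k \<le> i \<Longrightarrow> i < m \<Longrightarrow> x \<otimes> g i = g i \<otimes> x"
  shows "x \<otimes> sum_U k m = sum_U k m \<otimes> x"
  unfolding sum_U_def using assms by (intro finsum_commute commute_U) auto

lemma commute_sum_D:
  assumes "x \<in> carrier R" "\<And>i. k \<le> i \<Longrightarrow> i < m \<Longrightarrow> x \<otimes> g i = g i \<otimes> x"
  shows "x \<otimes> sum_D k m = sum_D k m \<otimes> x"
  unfolding sum_D_def using assms by (intro finsum_commute commute_D) auto

lemma sum_D_U:
  assumes "1 \<le> k" "k \<le> j" "Suc j \<le> m" "m \<le> N"
  shows "sum_D k j \<otimes> U k m = U k m \<otimes> sum_D (Suc k) (Suc j)"
  using assms(2,3)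
proof (induction j rule: dec_induct)
  case (step j)
  then show ?case
    using assms by (simp add: sum_D_upper l_distr r_distr U_shift_D del: D_snoc)
qed simp

lemma sum_U_U:
  assumes "1 \<le> k" "k \<le> j" "Suc j \<le> m" "m \<le> N"
  shows "sum_U k j \<otimes> U k m = U k m \<otimes> sum_U (Suc k) (Suc j)"
  using assms(2,3)
proof (induction j rule: dec_induct)
  case (step j)
  have "sum_U k (Suc j) \<otimes> U k m = U k m \<oplus> g j \<otimes> (sum_U k j \<otimes> U k m)"
    using step by (simp add: sum_U_upper l_distr m_assoc)
  also have "\<dots> = U k m \<oplus> (g j \<otimes> U k m) \<otimes> sum_U (Suc k) (Suc j)"
    using step by (simp add: m_assoc)
  also have "\<dots> = U k m \<otimes> sum_U (Suc k) (Suc (Suc j))"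
    using step assms by (simp add: U_shift sum_U_upper r_distr m_assoc)
  finally show ?case .
qed simp

text \<open>
  Both sides run over the coset representatives of the permutations of \<open>k + 1, \<dots>, m\<close> among those of
  \<open>k, \<dots>, m + 1\<close>: on the left through the permutations of \<open>k, \<dots>, m\<close>, on the right through those
  of \<open>k + 1, \<dots>, m + 1\<close>.
\<close>

lemma sum_D_sum_U_exchange:
  assumes "1 \<le> k" "k \<le> m" "Suc m \<le> N"
  shows "sum_D k m \<otimes> sum_U k (Suc m) = sum_U (Suc k) (Suc m) \<otimes> sum_D k (Suc m)"
  using assms(2,1)
proof (induction k rule: inc_induct)
  case base
  show ?case by (simp add: sum_U_lower[of m "Suc m"] sum_D_upper[of m m] D_snoc U_Cons)
next
  case (step k)
  let ?M = "Suc m"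
  have comm: "g k \<otimes> sum_U (Suc (Suc k)) ?M = sum_U (Suc (Suc k)) ?M \<otimes> g k"
    by (rule commute_sum_U) (auto intro: gen_commute)
  have "sum_D k m \<otimes> sum_U k ?M = sum_D k m \<otimes> sum_U (Suc k) ?M \<oplus> sum_D k m \<otimes> U k ?M"
    using step by (simp add: sum_U_lower[of k ?M] r_distr)
  also have "sum_D k m \<otimes> sum_U (Suc k) ?M
      = sum_U (Suc k) ?M \<oplus> g k \<otimes> (sum_D (Suc k) m \<otimes> sum_U (Suc k) ?M)"
    using step by (simp add: sum_D_lower[of k m] l_distr m_assoc)
  also have "sum_D (Suc k) m \<otimes> sum_U (Suc k) ?M = sum_U (Suc (Suc k)) ?M \<otimes> sum_D (Suc k) ?M"
    using step by simp
  also have "g k \<otimes> (sum_U (Suc (Suc k)) ?M \<otimes> sum_D (Suc k) ?M)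
      = sum_U (Suc (Suc k)) ?M \<otimes> (g k \<otimes> sum_D (Suc k) ?M)"
    using comm by (simp flip: m_assoc)
  also have "sum_D k m \<otimes> U k ?M = U (Suc k) ?M \<otimes> (g k \<otimes> sum_D (Suc k) ?M)"
  proof -
    have "sum_D k m \<otimes> U k ?M = U k ?M \<otimes> sum_D (Suc k) ?M"
      using step assms by (intro sum_D_U) auto
    then show ?thesis
      using step by (simp add: U_snoc[of k ?M] m_assoc)
  qed
  also have "sum_U (Suc k) ?M \<oplus> sum_U (Suc (Suc k)) ?M \<otimes> (g k \<otimes> sum_D (Suc k) ?M)
        \<oplus> U (Suc k) ?M \<otimes> (g k \<otimes> sum_D (Suc k) ?M)
      = sum_U (Suc k) ?M \<otimes> (\<one> \<oplus> g k \<otimes> sum_D (Suc k) ?M)"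
    using step by (simp add: sum_U_lower[of "Suc k" ?M] r_distr l_distr a_ac)
  finally show ?case
    using step by (simp add: sum_D_lower[of k ?M])
qed

text \<open>
  The symmetrizer can also be built up by adding the first strand. Type B needs this form, because
  there the special generator \<open>y\<close> stays next to the last strand.
\<close>

lemma symm_lower:
  assumes "1 \<le> k" "k \<le> m" "m \<le> N"
  shows "symm k m = symm (Suc k) m \<otimes> sum_D k m"
  using assms(2,3)
proof (induction m rule: dec_induct)
  case base
  show ?case by (simp add: symm_empty)
next
  case (step m)
  have "symm k (Suc m) = symm (Suc k) m \<otimes> (sum_D k m \<otimes> sum_U k (Suc m))"
    using step by (simp add: symm_upper m_assoc)
  also have "\<dots> = symm (Suc k) m \<otimes> sum_U (Suc k) (Suc m) \<otimes> sum_D k (Suc m)"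
    using step assms by (simp add: sum_D_sum_U_exchange m_assoc)
  finally show ?case
    using step by (simp add: symm_upper)
qed

text \<open>
  Of the terms of \<open>sum_U k (Suc n) \<otimes> U k (Suc n)\<close>, the first one, \<open>U k (Suc n)\<close>, cancels against the
  last term of \<open>sum_U k (Suc n)\<close>; in the others, \<open>g n\<close> can be pulled out to the left and moving
  \<open>U k (Suc n)\<close> to the left raises the remaining indices by one.
\<close>

lemma sum_U_telescope:
  assumes "1 \<le> k" "k \<le> Suc n" "Suc n \<le> N"
  shows "sum_U k (Suc n) \<otimes> list_prod R (map (\<lambda>i. \<one> \<ominus> U i (Suc n)) [k..<Suc n])
    = list_prod R (map (\<lambda>i. \<one> \<ominus> g n \<otimes> U i (Suc n)) [k..<Suc n])"
  using assms(2,1)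
proof (induction k rule: inc_induct)
  case base
  show ?case by simp
next
  case (step k)
  let ?T = "sum_U (Suc k) (Suc n)" and ?U = "U k (Suc n)"
  have TU: "sum_U k n \<otimes> ?U = ?U \<otimes> ?T"
    using step assms by (intro sum_U_U) auto
  have "sum_U k (Suc n) \<otimes> (\<one> \<ominus> ?U) = ?T \<oplus> ?U \<ominus> sum_U k (Suc n) \<otimes> ?U"
    using step by (simp add: sum_U_lower[of k "Suc n"] minus_eq r_distr l_distr r_minus)
  also have "sum_U k (Suc n) \<otimes> ?U = ?U \<oplus> g n \<otimes> (sum_U k n \<otimes> ?U)"
    using step by (simp add: sum_U_upper l_distr m_assoc)
  also have "?T \<oplus> ?U \<ominus> (?U \<oplus> g n \<otimes> (sum_U k n \<otimes> ?U)) = (\<one> \<ominus> g n \<otimes> ?U) \<otimes> ?T"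
  proof -
    have cancel: "u \<oplus> (t \<oplus> (\<ominus> u \<oplus> x)) = t \<oplus> x"
      if "u \<in> carrier R" "t \<in> carrier R" "x \<in> carrier R" for u t x
      using that by (subst a_lcomm) (simp_all add: r_neg2)
    show ?thesis
      unfolding TU by (simp add: minus_eq minus_add l_distr l_minus m_assoc a_ac cancel)
  qed
  finally have *: "sum_U k (Suc n) \<otimes> (\<one> \<ominus> ?U) = (\<one> \<ominus> g n \<otimes> ?U) \<otimes> ?T" .
  define X where "X = list_prod R (map (\<lambda>i. \<one> \<ominus> U i (Suc n)) [Suc k..<Suc n])"
  have X: "X \<in> carrier R"
    unfolding X_def by (rule list_prod_closed) auto
  have "sum_U k (Suc n) \<otimes> list_prod R (map (\<lambda>i. \<one> \<ominus> U i (Suc n)) [k..<Suc n])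
    = sum_U k (Suc n) \<otimes> ((\<one> \<ominus> ?U) \<otimes> X)"
    using step by (simp add: X_def upt_conv_Cons del: upt_Suc)
  also have "\<dots> = (sum_U k (Suc n) \<otimes> (\<one> \<ominus> ?U)) \<otimes> X"
    using X by (simp add: m_assoc)
  also have "\<dots> = (\<one> \<ominus> g n \<otimes> ?U) \<otimes> (?T \<otimes> X)"
    unfolding * using X by (simp add: m_assoc)
  also have "?T \<otimes> X = list_prod R (map (\<lambda>i. \<one> \<ominus> g n \<otimes> U i (Suc n)) [Suc k..<Suc n])"
    unfolding X_def using step by simp
  finally show ?case
    using step by (simp add: upt_conv_Cons del: upt_Suc)
qed

end

text \<open>
  The partial products \<open>W\<^sub>j = V\<^sub>0 \<dots> V\<^sub>j\<^sub>-\<^sub>1\<close> stand for symmetrizers of an increasing chain of groups, and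
  the recursion of \<open>V\<close> for their decomposition into the double cosets of \<open>1\<close>, \<open>h\<^sub>j\<close> and \<open>z\<^sub>j\<close>. If
  \<open>W\<^sub>j\<^sub>+\<^sub>1 = W\<^sub>j V\<^sub>j = V'\<^sub>j W\<^sub>j\<close> is known, then the middle term is symmetric as well:
  \<open>W\<^sub>j\<^sub>+\<^sub>1 h\<^sub>j V\<^sub>j = V'\<^sub>j W\<^sub>j h\<^sub>j V\<^sub>j = V'\<^sub>j h\<^sub>j W\<^sub>j V\<^sub>j = V'\<^sub>j h\<^sub>j W\<^sub>j\<^sub>+\<^sub>1\<close>.
\<close>

lemma (in ring) palindromic:
  assumes closed: "\<And>j. h j \<in> carrier R" "\<And>j. z j \<in> carrier R"
      "\<And>j. V j \<in> carrier R" "\<And>j. V' j \<in> carrier R"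
    and "V' 0 = V 0"
    and V: "\<And>j. j < n \<Longrightarrow> V (Suc j) = \<one> \<oplus> h j \<otimes> V j \<oplus> z j"
    and V': "\<And>j. j < n \<Longrightarrow> V' (Suc j) = \<one> \<oplus> V' j \<otimes> h j \<oplus> z j"
    and h: "\<And>j. j < n \<Longrightarrow>
      h j \<otimes> list_prod R (map V [0..<j]) = list_prod R (map V [0..<j]) \<otimes> h j"
    and z: "\<And>j. j < n \<Longrightarrow>
      z j \<otimes> list_prod R (map V [0..<Suc j]) = list_prod R (map V [0..<Suc j]) \<otimes> z j"
  shows "j \<le> Suc n \<Longrightarrow> list_prod R (map V [0..<j]) = list_prod R (map V' (rev [0..<j]))"
proof (induction j rule: less_induct)
  case (less j)
  define W where "W j = list_prod R (map V [0..<j])" for j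
  have W[simp, intro]: "W j \<in> carrier R" for j
    unfolding W_def using closed by (intro list_prod_closed) auto
  have W_Suc: "W (Suc j) = W j \<otimes> V j" for j
    unfolding W_def using closed by (simp add: list_prod_append image_subset_iff)
  note [simp] = closed
  show ?case
  proof (cases "j < 2")
    case True
    then have "j = 0 \<or> j = 1" by linarith
    then show ?thesis using closed assms by auto
  next
    case False
    then obtain i where j: "j = Suc (Suc i)"
      by (metis One_nat_def Suc_1 less_Suc_eq_0_disj not0_implies_Suc not_less_eq)
    have i: "i < n" using less.prems j by simp
    define W' where "W' = list_prod R (map V' (rev [0..<Suc i]))"
    have W': "W' = W (Suc i)"
      unfolding W_def W'_def using less.IH[of "Suc i"] less.prems j by simp
    have "W' = V' i \<otimes> list_prod R (map V' (rev [0..<i]))"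
      by (simp add: W'_def)
    also have "list_prod R (map V' (rev [0..<i])) = W i"
      unfolding W_def using less.IH[of i] less.prems j by simp
    finally have W'_Suc: "W (Suc i) = V' i \<otimes> W i" by (simp add: W')
    have hW: "h i \<otimes> W i = W i \<otimes> h i" and zW: "z i \<otimes> W (Suc i) = W (Suc i) \<otimes> z i"
      unfolding W_def using h[OF i] z[OF i] by blast+
    have "W (Suc i) \<otimes> (h i \<otimes> V i) = V' i \<otimes> ((W i \<otimes> h i) \<otimes> V i)"
      by (simp add: W'_Suc m_assoc)
    also have "\<dots> = V' i \<otimes> (h i \<otimes> W (Suc i))"
      by (simp add: W_Suc m_assoc flip: hW)
    finally have "W (Suc i) \<otimes> V (Suc i) = V' (Suc i) \<otimes> W (Suc i)"
      using i by (simp add: V V' r_distr l_distr m_assoc zW)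
    moreover have "list_prod R (map V' (rev [0..<j])) = V' (Suc i) \<otimes> W (Suc i)"
      by (simp add: j flip: W' add: W'_def)
    ultimately show ?thesis
      by (simp only: W_Suc[of "Suc i"] j flip: W_def)
  qed
qed

lemma (in braid_ring) braid_ring_opposite: "braid_ring (opposite R) g N"
proof -
  interpret op: ring "opposite R" by (rule ring_opposite)
  show ?thesis
  proof
    show "g i \<otimes>\<^bsub>opposite R\<^esub> g j = g j \<otimes>\<^bsub>opposite R\<^esub> g i" if "Suc i < j" for i j
      using gen_commute[OF that] by simp
    show "g i \<otimes>\<^bsub>opposite R\<^esub> g (Suc i) \<otimes>\<^bsub>opposite R\<^esub> g i
        = g (Suc i) \<otimes>\<^bsub>opposite R\<^esub> g i \<otimes>\<^bsub>opposite R\<^esub> g (Suc i)"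
      if "1 \<le> i" "Suc i < N" for i
      using gen_braid[OF that] by (simp add: m_assoc)
  qed simp
qed

context braid_ring
begin

lemma word_opposite: "braid_monoid.word (opposite R) g w = word (rev w)"
proof -
  interpret op: braid_ring "opposite R" g N
    by (rule braid_ring_opposite)
  show ?thesis
    unfolding op.word_def word_def
    by (subst list_prod_opposite) (auto simp: rev_map)
qed

text \<open>
  The symmetrizer is invariant under reversal: \<open>palindromic\<close> applies to \<open>V\<^sub>j = sum_U k (k + j)\<close> with
  \<open>h\<^sub>j = g (k + j)\<close> and \<open>z\<^sub>j = 0\<close>.
\<close>

lemma symm_opposite:
  assumes "k \<le> m"
  shows "braid_ring.symm (opposite R) g k m = symm k m"
proof -
  interpret op: braid_ring "opposite R" g N
    by (rule braid_ring_opposite)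
  define j where "j = Suc m - k"
  have upt: "[k..<Suc m] = map (\<lambda>i. k + i) [0..<j]"
    using assms map_add_upt[of k j] by (simp add: j_def add.commute)
  have "list_prod R (map (\<lambda>i. sum_U k (k + i)) [0..<j])
      = list_prod R (map (\<lambda>i. op.sum_U k (k + i)) (rev [0..<j]))"
  proof (rule palindromic)
    show "j \<le> Suc j" by simp
    show "sum_U k (k + Suc i) = \<one> \<oplus> g (k + i) \<otimes> sum_U k (k + i) \<oplus> \<zero>" for i
      by (simp add: sum_U_upper)
    show "op.sum_U k (k + Suc i) = \<one> \<oplus> op.sum_U k (k + i) \<otimes> g (k + i) \<oplus> \<zero>" for i
      using op.sum_U_closed by (simp add: op.sum_U_upper)
    show "g (k + i) \<otimes> list_prod R (map (\<lambda>i. sum_U k (k + i)) [0..<i])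
        = list_prod R (map (\<lambda>i. sum_U k (k + i)) [0..<i]) \<otimes> g (k + i)" for i
      by (rule list_prod_commute) (auto intro!: commute_sum_U gen_commute[symmetric])
    have "list_prod R (map (\<lambda>i. sum_U k (k + i)) [0..<Suc i]) \<in> carrier R" for i
      by (rule list_prod_closed) auto
    then show "\<zero> \<otimes> list_prod R (map (\<lambda>i. sum_U k (k + i)) [0..<Suc i])
        = list_prod R (map (\<lambda>i. sum_U k (k + i)) [0..<Suc i]) \<otimes> \<zero>" for i
      by (simp del: upt_Suc)
  qed (use op.sum_U_closed in auto)
  then show ?thesis
    unfolding symm_def op.symm_def using op.sum_U_closed
    by (subst list_prod_opposite) (auto simp: ring_axioms upt rev_map o_def simp del: upt_Suc)
qed

end

section \<open>Symmetrizers of type B\<close>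

text \<open>
  The Coxeter diagram of type B is the path \<open>y, g (n - 1), \<dots>, g 1\<close> with a double bond at \<open>y\<close>.
\<close>

locale type_B = braid_ring R g N
  for R :: "('a, 'm) ring_scheme" (structure) and g N +
  fixes n :: nat and y :: 'a
  assumes n_le: "n \<le> N"
    and y_closed [simp, intro]: "y \<in> carrier R"
    and y_commute: "1 \<le> i \<Longrightarrow> Suc i < n \<Longrightarrow> y \<otimes> g i = g i \<otimes> y"
    and y_braid: "1 \<le> i \<Longrightarrow> Suc i = n \<Longrightarrow> g i \<otimes> y \<otimes> g i \<otimes> y = y \<otimes> g i \<otimes> y \<otimes> g i"
begin

text \<open>
  Multiplied out, this is the sum of the lifts of the shortest representatives of the cosets of the
  symmetric group on \<open>k, \<dots>, n\<close> in the hyperoctahedral group on the same points.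
\<close>

definition prod_B :: "nat \<Rightarrow> 'a" where
  "prod_B k = list_prod R (map (\<lambda>i. \<one> \<oplus> y \<otimes> U i n) [k..<Suc n])"

text \<open>
  The lift of the signed permutation that changes the sign of \<open>k\<close> only.
\<close>

definition loop :: "nat \<Rightarrow> 'a" where
  "loop k = D k n \<otimes> y \<otimes> U k n"

text \<open>
  The sum of the lifts of the shortest representatives of the cosets, in the hyperoctahedral group
  on \<open>k, \<dots>, n\<close>, of the subgroup on \<open>k + 1, \<dots>, n\<close>. The first summand
  comprises the representatives without a sign change, the second one those with a sign change.
\<close>

definition coset_B :: "nat \<Rightarrow> 'a" where
  "coset_B k = sum_D k n \<oplus> D k n \<otimes> y \<otimes> sum_U k n"

definition symm_B :: "nat \<Rightarrow> 'a" where
  "symm_B k = list_prod R (map coset_B (rev [k..<Suc n]))"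

lemma prod_B_closed [simp, intro]: "prod_B k \<in> carrier R"
  unfolding prod_B_def by (rule list_prod_closed) auto

lemma coset_B_closed [simp, intro]: "coset_B k \<in> carrier R"
  and loop_closed [simp, intro]: "loop k \<in> carrier R"
  by (auto simp: coset_B_def loop_def)

lemma symm_B_closed [simp, intro]: "symm_B k \<in> carrier R"
  unfolding symm_B_def by (rule list_prod_closed) auto

lemma prod_B_top [simp]: "prod_B (Suc n) = \<one>"
  and prod_B_rec: "k \<le> n \<Longrightarrow> prod_B k = (\<one> \<oplus> y \<otimes> U k n) \<otimes> prod_B (Suc k)"
  by (simp_all add: prod_B_def upt_conv_Cons del: upt_Suc)

lemma symm_B_top [simp]: "symm_B (Suc n) = \<one>"
  and symm_B_rec: "k \<le> n \<Longrightarrow> symm_B k = symm_B (Suc k) \<otimes> coset_B k"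
  by (simp_all add: symm_B_def upt_conv_Cons list_prod_append image_subset_iff del: upt_Suc)

lemma coset_B_top: "coset_B n = \<one> \<oplus> y"
  by (simp add: coset_B_def)

text \<open>
  The double cosets of the subgroup on \<open>k + 1, \<dots>, n\<close> are those of \<open>1\<close>, \<open>g k\<close> and \<open>loop k\<close>.
\<close>

lemma coset_B_rec: "k < n \<Longrightarrow> coset_B k = \<one> \<oplus> g k \<otimes> coset_B (Suc k) \<oplus> loop k"
  by (simp add: coset_B_def loop_def sum_D_lower[of k n] sum_U_lower[of k n] D_Cons[of k n]
      r_distr a_assoc m_assoc)

lemma commute_prod_B:
  assumes "x \<in> carrier R" "x \<otimes> y = y \<otimes> x" "\<And>i. k \<le> i \<Longrightarrow> i < n \<Longrightarrow> x \<otimes> g i = g i \<otimes> x"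
  shows "x \<otimes> prod_B k = prod_B k \<otimes> x"
  unfolding prod_B_def
proof (rule list_prod_commute)
  fix a assume "a \<in> set (map (\<lambda>i. \<one> \<oplus> y \<otimes> U i n) [k..<Suc n])"
  then obtain i where i: "k \<le> i" "a = \<one> \<oplus> y \<otimes> U i n"
    by (auto simp del: upt_Suc)
  have "x \<otimes> U i n = U i n \<otimes> x"
    using assms i by (intro commute_U) auto
  then have "x \<otimes> (y \<otimes> U i n) = y \<otimes> U i n \<otimes> x"
    using assms by (metis U_closed m_assoc y_closed)
  then show "x \<otimes> a = a \<otimes> x"
    using assms(1) i by (simp add: l_distr r_distr)
qed (use assms in auto)

lemma commute_coset_B:
  assumes "x \<in> carrier R" "x \<otimes> y = y \<otimes> x" "\<And>i. k \<le> i \<Longrightarrow> i < n \<Longrightarrow> x \<otimes> g i = g i \<otimes> x"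
  shows "x \<otimes> coset_B k = coset_B k \<otimes> x"
proof -
  have 1: "x \<otimes> sum_D k n = sum_D k n \<otimes> x" "x \<otimes> sum_U k n = sum_U k n \<otimes> x" "x \<otimes> D k n = D k n \<otimes> x"
    using assms by (auto intro!: commute_sum_D commute_sum_U commute_D)
  have "x \<otimes> (D k n \<otimes> y \<otimes> sum_U k n) = D k n \<otimes> y \<otimes> sum_U k n \<otimes> x"
    using 1 assms(1,2) by (metis D_closed sum_U_closed m_assoc m_closed y_closed)
  with 1 show ?thesis
    using assms(1) by (simp add: coset_B_def l_distr r_distr)
qed

text \<open>
  Passing \<open>D k n\<close> lowers the index of \<open>g i\<close>, which makes it commute with \<open>y\<close>; passing \<open>U k n\<close>
  raises it again.
\<close>

lemma loop_commute_gen: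
  assumes "1 \<le> k" "k < i" "i < n"
  shows "loop k \<otimes> g i = g i \<otimes> loop k"
proof -
  obtain j where i: "i = Suc j" using assms by (cases i) auto
  have y: "y \<otimes> g j = g j \<otimes> y"
    using assms i by (intro y_commute) auto
  have D: "D k n \<otimes> g j = g i \<otimes> D k n" and U: "g j \<otimes> U k n = U k n \<otimes> g i"
    unfolding i using assms i n_le by (auto intro!: D_shift U_shift)
  have "loop k \<otimes> g i = D k n \<otimes> (y \<otimes> g j) \<otimes> U k n"
    unfolding loop_def by (simp add: m_assoc U)
  also have "\<dots> = (D k n \<otimes> g j) \<otimes> (y \<otimes> U k n)"
    unfolding y by (simp add: m_assoc)
  finally show ?thesis
    unfolding D by (simp add: loop_def m_assoc)
qed

lemma loop_commute_y:
  assumes "1 \<le> k" "k < n"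
  shows "loop k \<otimes> y = y \<otimes> loop k"
proof -
  obtain m where n: "n = Suc m" "k \<le> m" using assms by (cases n) auto
  have b: "g m \<otimes> (y \<otimes> (g m \<otimes> y)) = y \<otimes> (g m \<otimes> (y \<otimes> g m))"
    using y_braid[of m] assms n by (simp add: m_assoc)
  have D: "y \<otimes> D k m = D k m \<otimes> y" and U: "y \<otimes> U k m = U k m \<otimes> y"
    using assms n by (auto intro!: commute_D commute_U y_commute)
  have "loop k \<otimes> y = D k m \<otimes> (g m \<otimes> (y \<otimes> (g m \<otimes> y))) \<otimes> U k m"
    unfolding loop_def using n by (simp add: D_snoc U_Cons m_assoc U)
  also have "\<dots> = (y \<otimes> D k m) \<otimes> (g m \<otimes> (y \<otimes> g m)) \<otimes> U k m"
    unfolding b D by (simp add: m_assoc)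
  finally show ?thesis
    unfolding loop_def using n by (simp add: D_snoc U_Cons m_assoc)
qed

text \<open>
  Both sides run over the coset representatives of the symmetric group on \<open>k + 1, \<dots>, n\<close> in the
  hyperoctahedral group on \<open>k, \<dots>, n\<close>: on the left through the symmetric group on \<open>k, \<dots>, n\<close>, on
  the right through the hyperoctahedral group on \<open>k + 1, \<dots>, n\<close>. Splitting off the factor
  \<open>\<one> \<oplus> y \<otimes> U k n\<close> of \<open>prod_B k\<close> and using \<open>coset_B_rec\<close> on the right, both become the same three
  terms by the induction hypothesis.
\<close>

lemma sum_D_prod_B_exchange:
  assumes "1 \<le> k" "k \<le> n"
  shows "sum_D k n \<otimes> prod_B k = prod_B (Suc k) \<otimes> coset_B k"
  using assms(2,1)
proof (induction k rule: inc_induct)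
  case base
  show ?case by (simp add: prod_B_rec coset_B_top)
next
  case (step k)
  obtain m where n: "n = Suc m" "k \<le> m" using step by (cases n) auto
  let ?P = "prod_B (Suc k)" and ?P' = "prod_B (Suc (Suc k))" and ?V = "coset_B (Suc k)"
  \<comment> \<open>For \<open>Suc k = n\<close> the generator \<open>g k\<close> does not commute with \<open>y\<close>, but then \<open>?P'\<close> is the unit.\<close>
  have gP: "g k \<otimes> ?P' = ?P' \<otimes> g k"
  proof (cases "Suc k = n")
    case False
    with step show ?thesis
      by (intro commute_prod_B) (auto intro: gen_commute y_commute[symmetric])
  qed simp
  have ZP: "loop k \<otimes> ?P = ?P \<otimes> loop k"
    using step by (intro commute_prod_B) (auto intro: loop_commute_gen loop_commute_y)
  have FP: "sum_D k n \<otimes> ?P = ?P \<oplus> ?P' \<otimes> (g k \<otimes> ?V)"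
  proof -
    have "sum_D k n \<otimes> ?P = ?P \<oplus> g k \<otimes> (sum_D (Suc k) n \<otimes> ?P)"
      using step by (simp add: sum_D_lower[of k n] l_distr m_assoc)
    also have "\<dots> = ?P \<oplus> (g k \<otimes> ?P') \<otimes> ?V"
      using step by (simp add: m_assoc)
    finally show ?thesis
      unfolding gP by (simp add: m_assoc)
  qed
  have FyU: "sum_D k n \<otimes> (y \<otimes> U k n) = y \<otimes> U k n \<otimes> sum_D (Suc k) n \<oplus> loop k"
  proof -
    have 1: "sum_D k m \<otimes> U k n = U k n \<otimes> sum_D (Suc k) n"
      unfolding n using step n n_le by (intro sum_D_U) auto
    have 2: "y \<otimes> sum_D k m = sum_D k m \<otimes> y"
      using step n by (intro commute_sum_D) (auto intro: y_commute)
    have "sum_D k n \<otimes> (y \<otimes> U k n) = (sum_D k m \<otimes> y) \<otimes> U k n \<oplus> loop k"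
      unfolding loop_def using n by (simp add: sum_D_upper l_distr m_assoc)
    also have "\<dots> = y \<otimes> (sum_D k m \<otimes> U k n) \<oplus> loop k"
      unfolding 2[symmetric] by (simp add: m_assoc)
    finally show ?thesis
      unfolding 1 by (simp add: m_assoc)
  qed
  have "sum_D k n \<otimes> prod_B k = sum_D k n \<otimes> ?P \<oplus> sum_D k n \<otimes> (y \<otimes> U k n) \<otimes> ?P"
    using step by (simp add: prod_B_rec[of k] l_distr r_distr m_assoc)
  also have "\<dots> = sum_D k n \<otimes> ?P \<oplus> y \<otimes> U k n \<otimes> (sum_D (Suc k) n \<otimes> ?P) \<oplus> loop k \<otimes> ?P"
    unfolding FyU by (simp add: l_distr a_assoc m_assoc)
  also have "sum_D (Suc k) n \<otimes> ?P = ?P' \<otimes> ?V"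
    using step by simp
  also have "y \<otimes> U k n \<otimes> (?P' \<otimes> ?V) = y \<otimes> U (Suc k) n \<otimes> ((g k \<otimes> ?P') \<otimes> ?V)"
    using step by (simp add: U_snoc[of k n] m_assoc)
  also have "sum_D k n \<otimes> ?P \<oplus> y \<otimes> U (Suc k) n \<otimes> ((g k \<otimes> ?P') \<otimes> ?V) \<oplus> loop k \<otimes> ?P
      = ?P \<oplus> (\<one> \<oplus> y \<otimes> U (Suc k) n) \<otimes> ?P' \<otimes> (g k \<otimes> ?V) \<oplus> ?P \<otimes> loop k"
    unfolding FP gP ZP by (simp add: l_distr m_assoc a_assoc)
  also have "\<dots> = ?P \<otimes> coset_B k"
    using step by (simp add: prod_B_rec[of "Suc k"] coset_B_rec r_distr)
  finally show ?case .
qed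

lemma symm_prod_B_eq_symm_B:
  assumes "1 \<le> k" "k \<le> Suc n"
  shows "symm k n \<otimes> prod_B k = symm_B k"
  using assms(2,1)
proof (induction k rule: inc_induct)
  case base
  show ?case by (simp add: symm_empty)
next
  case (step k)
  have "symm k n \<otimes> prod_B k = symm (Suc k) n \<otimes> (sum_D k n \<otimes> prod_B k)"
    using step n_le by (simp add: symm_lower[of k n] m_assoc)
  also have "\<dots> = symm (Suc k) n \<otimes> prod_B (Suc k) \<otimes> coset_B k"
    using step.hyps step.prems by (simp add: sum_D_prod_B_exchange m_assoc)
  finally show ?case
    using step by (simp add: symm_B_rec)
qed

lemma type_B_opposite: "type_B (opposite R) g N n y"
proof -
  interpret op: braid_ring "opposite R" g N by (rule braid_ring_opposite)
  show ?thesis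
    by unfold_locales (use n_le y_commute y_braid in \<open>simp_all add: m_assoc\<close>)
qed

text \<open>
  An instance of \<open>palindromic\<close> with \<open>V\<^sub>i = coset_B (n - i)\<close>, \<open>h\<^sub>i = g (n - i - 1)\<close> and
  \<open>z\<^sub>i = loop (n - i - 1)\<close>: strands are added from the last one downwards.
\<close>

lemma symm_B_opposite:
  assumes "1 \<le> k" "k \<le> n"
  shows "symm_B k = type_B.symm_B (opposite R) g n y k"
proof -
  interpret op: type_B "opposite R" g N n y by (rule type_B_opposite)
  define j where "j = Suc n - k"
  have loop_op: "op.loop k = loop k" for k
    by (simp add: op.loop_def loop_def op.D_def op.U_def D_def U_def word_opposite m_assoc)
  have rev: "rev [k..<Suc n] = map (\<lambda>i. n - i) [0..<j]"
    using assms by (intro nth_equalityI) (auto simp: j_def rev_nth simp del: upt_Suc)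
  have "list_prod R (map (\<lambda>i. coset_B (n - i)) [0..<j])
      = list_prod R (map (\<lambda>i. op.coset_B (n - i)) (rev [0..<j]))"
  proof (rule palindromic[where n = "n - k"])
    show "j \<le> Suc (n - k)" using assms by (simp add: j_def)
    fix i assume i: "i < n - k"
    have [simp]: "Suc (n - Suc i) = n - i" using i by simp
    show "coset_B (n - Suc i) = \<one> \<oplus> g (n - Suc i) \<otimes> coset_B (n - i) \<oplus> loop (n - Suc i)"
      using i coset_B_rec[of "n - Suc i"] by simp
    show "op.coset_B (n - Suc i) = \<one> \<oplus> op.coset_B (n - i) \<otimes> g (n - Suc i) \<oplus> loop (n - Suc i)"
      using i op.coset_B_rec[of "n - Suc i"] by (simp add: loop_op)
    show "g (n - Suc i) \<otimes> list_prod R (map (\<lambda>i. coset_B (n - i)) [0..<i])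
        = list_prod R (map (\<lambda>i. coset_B (n - i)) [0..<i]) \<otimes> g (n - Suc i)"
      using i assms
      by (intro list_prod_commute) (auto intro!: commute_coset_B y_commute[symmetric] gen_commute)
    show "loop (n - Suc i) \<otimes> list_prod R (map (\<lambda>i. coset_B (n - i)) [0..<Suc i])
        = list_prod R (map (\<lambda>i. coset_B (n - i)) [0..<Suc i]) \<otimes> loop (n - Suc i)"
      using i assms
      by (intro list_prod_commute)
        (auto intro!: commute_coset_B loop_commute_y loop_commute_gen simp del: upt_Suc)
  qed (use op.coset_B_closed in \<open>auto simp: coset_B_top op.coset_B_top\<close>)
  then show ?thesis
    unfolding symm_B_def op.symm_B_def using op.coset_B_closed
    by (subst list_prod_opposite) (auto simp: rev o_def simp flip: rev_map simp del: upt_Suc)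
qed

text \<open>
  By \<open>symm_prod_B_eq_symm_B\<close>, the left hand side is the type B symmetrizer, and its mirror image in
  the opposite ring, which is the right hand side, is the mirror image of that symmetrizer.
\<close>

lemma symm_prod_B_exchange:
  assumes "1 \<le> n"
  shows "symm 1 n \<otimes> list_prod R (map (\<lambda>i. \<one> \<oplus> y \<otimes> U i n) [1..<Suc n])
    = list_prod R (map (\<lambda>i. \<one> \<oplus> D i n \<otimes> y) (rev [1..<Suc n])) \<otimes> symm 1 n"
proof -
  interpret op: type_B "opposite R" g N n y by (rule type_B_opposite)
  have op_prod_B: "op.prod_B 1 = list_prod R (map (\<lambda>i. \<one> \<oplus> D i n \<otimes> y) (rev [1..<Suc n]))"
    unfolding op.prod_B_def
    by (subst list_prod_opposite) (auto simp: op.U_def word_opposite D_def rev_map)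
  have "symm 1 n \<otimes> prod_B 1 = op.symm 1 n \<otimes>\<^bsub>opposite R\<^esub> op.prod_B 1"
    using assms symm_prod_B_eq_symm_B[of 1] op.symm_prod_B_eq_symm_B[of 1]
      symm_B_opposite[of 1] by simp
  also have "\<dots> = op.prod_B 1 \<otimes> symm 1 n"
    using assms by (simp add: symm_opposite)
  finally show ?thesis
    unfolding op_prod_B prod_B_def by simp
qed

end

section \<open>Canonical words and Matsumoto's theorem\<close>

definition perm :: "nat list \<Rightarrow> nat \<Rightarrow> nat" where
  "perm w = foldr (\<lambda>i f. Transposition.transpose i (Suc i) \<circ> f) w id"

lemma perm_Nil [simp]: "perm [] = id"
  and perm_Cons [simp]: "perm (i # w) = Transposition.transpose i (Suc i) \<circ> perm w"
  by (simp_all add: perm_def)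

lemma perm_append [simp]: "perm (v @ w) = perm v \<circ> perm w"
  by (induction v) (auto simp: o_assoc)

lemma perm_permutes: "w \<in> lists {1..<m} \<Longrightarrow> perm w permutes {1..m}"
proof (induction w)
  case (Cons i w)
  then have "Transposition.transpose i (Suc i) permutes {1..m}"
    by (intro permutes_swap_id) auto
  moreover have "perm w permutes {1..m}"
    using Cons by auto
  ultimately show ?case
    unfolding perm_Cons by (rule permutes_compose[rotated])
qed (simp add: permutes_id)

lemma inj_perm: "inj (perm w)"
proof (induction w)
  case (Cons i w)
  then show ?case
    unfolding perm_Cons by (intro inj_compose inj_transpose)
qed simp

lemma list_prod_sym_group:
  "list_prod (sym_group n) (map (\<lambda>i. Transposition.transpose i (Suc i)) w) = perm w"
  by (induction w) (simp_all add: sym_group_def)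

text \<open>
  One word for each permutation of \<open>1, \<dots>, m\<close>: the last factor of a word in \<open>canonical (Suc m)\<close> moves
  position \<open>i\<close> to \<open>m + 1\<close>, and what precedes it permutes \<open>1, \<dots>, m\<close>.
\<close>

primrec canonical :: "nat \<Rightarrow> nat list set" where
  "canonical 0 = {[]}"
| "canonical (Suc m) = (\<lambda>(v, i). v @ rev [i..<Suc m]) ` (canonical m \<times> {1..Suc m})"

lemma canonicalE:
  assumes "w \<in> canonical (Suc m)"
  obtains v i where "v \<in> canonical m" "1 \<le> i" "i \<le> Suc m" "w = v @ rev [i..<Suc m]"
  using assms by auto

lemma canonicalI:
  "v \<in> canonical m \<Longrightarrow> 1 \<le> i \<Longrightarrow> i \<le> Suc m \<Longrightarrow> v @ rev [i..<Suc m] \<in> canonical (Suc m)"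
  by (auto simp del: upt_Suc)

lemma canonical_lists: "canonical m \<subseteq> lists {1..<m}"
proof (induction m)
  case (Suc m)
  then show ?case
    by (fastforce elim!: canonicalE simp del: upt_Suc canonical.simps(2))
qed simp

lemma finite_canonical [simp, intro]: "finite (canonical m)"
  by (induction m) auto

lemma perm_rev_upt:
  "i \<le> m \<Longrightarrow> perm (rev [i..<m]) i = m"
proof (induction m rule: dec_induct)
  case (step m)
  then show ?case by (simp add: Transposition.transpose_def)
qed simp

text \<open>
  The index of the last factor can be read off from the permutation, which is why different
  canonical words have different permutations.
\<close>

lemma perm_canonical_top:
  assumes "v \<in> canonical m" "i \<le> Suc m"
  shows "perm (v @ rev [i..<Suc m]) j = Suc m \<longleftrightarrow> j = i"
proof -
  have v: "perm v permutes {1..m}"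
    using assms canonical_lists perm_permutes by blast
  have r: "perm (rev [i..<Suc m]) i = Suc m"
    using assms by (intro perm_rev_upt)
  have "perm (v @ rev [i..<Suc m]) j = Suc m \<longleftrightarrow> perm (rev [i..<Suc m]) j = Suc m"
    using v permutes_not_in[OF v, of "Suc m"] permutes_inj[OF v]
    by (simp add: inj_eq[of "perm v"] del: upt_Suc)
      (metis atLeastAtMost_iff inj_eq not_less_eq_eq order_refl)
  also have "\<dots> \<longleftrightarrow> j = i"
    using inj_perm r by (metis inj_eq)
  finally show ?thesis .
qed

lemma inj_on_perm_canonical_snoc:
  assumes "inj_on perm (canonical m)"
  shows "inj_on (\<lambda>a. perm ((\<lambda>(v, i). v @ rev [i..<Suc m]) a)) (canonical m \<times> {1..Suc m})"
proof (rule inj_onI, clarify)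
  fix v i w j
  assume A: "v \<in> canonical m" "i \<in> {1..Suc m}" "w \<in> canonical m" "j \<in> {1..Suc m}"
    and eq: "perm (v @ rev [i..<Suc m]) = perm (w @ rev [j..<Suc m])"
  have ij: "i = j"
    using perm_canonical_top[of v m i i] perm_canonical_top[of w m j i] A
    unfolding eq by (auto simp del: upt_Suc)
  have "perm (rev [i..<Suc m]) permutes {1..Suc m}"
    using A by (intro perm_permutes) auto
  then have "surj (perm (rev [i..<Suc m]))" by (rule permutes_surj)
  with eq ij have "perm v = perm w"
    by (simp add: fun_eq_iff del: upt_Suc) (metis surjD)
  then show "v = w \<and> i = j"
    using assms A ij by (auto simp: inj_on_def)
qed

text \<open>
  Given injectivity, surjectivity follows by counting.
\<close>

lemma bij_betw_perm_canonical: "bij_betw perm (canonical m) {p. p permutes {1..m}}"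
proof (induction m)
  case 0
  then show ?case by (simp add: bij_betw_def id_def)
next
  case (Suc m)
  let ?f = "\<lambda>(v, i). v @ rev [i..<Suc m]" and ?A = "canonical m \<times> {1..Suc m}"
  have inj: "inj_on (\<lambda>a. perm (?f a)) ?A"
    using Suc by (intro inj_on_perm_canonical_snoc) (auto simp: bij_betw_def)
  have "card (canonical m) = fact m"
    using bij_betw_same_card[OF Suc] card_permutations[of "{1..m}" m] by simp
  then have "card ((\<lambda>a. perm (?f a)) ` ?A) = fact (Suc m)"
    by (subst card_image[OF inj]) simp
  moreover have "(\<lambda>a. perm (?f a)) ` ?A = perm ` canonical (Suc m)"
    by (simp add: image_image case_prod_beta del: upt_Suc)
  moreover have "perm ` canonical (Suc m) \<subseteq> {p. p permutes {1..Suc m}}"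
    using canonical_lists perm_permutes by blast
  moreover have "card {p. p permutes {1..Suc m}} = fact (Suc m)"
    by (rule card_permutations) auto
  ultimately have "perm ` canonical (Suc m) = {p. p permutes {1..Suc m}}"
    by (intro card_subset_eq) (auto intro: finite_permutations)
  moreover have "inj_on perm (canonical (Suc m))"
    using inj_on_imageI[of perm ?f ?A] inj by (simp add: o_def del: upt_Suc)
  ultimately show ?case by (simp add: bij_betw_def)
qed

text \<open>
  Adjacent transpositions satisfy the braid relations, so what is proved for words in an arbitrary
  braid monoid holds for permutations too. The carrier contains all maps because the locale has
  generators for all indices.
\<close>

definition self_maps :: "(nat \<Rightarrow> nat) monoid" where
  "self_maps = \<lparr>carrier = UNIV, mult = (\<circ>), one = id\<rparr>"

lemma braid_monoid_perm:
  "braid_monoid self_maps (\<lambda>i. Transposition.transpose i (Suc i)) N"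
  by unfold_locales (auto simp: self_maps_def o_assoc fun_eq_iff Transposition.transpose_def)

lemma word_perm:
  "braid_monoid.word self_maps (\<lambda>i. Transposition.transpose i (Suc i)) = perm"
proof
  fix w
  interpret P: braid_monoid "self_maps"
      "\<lambda>i. Transposition.transpose i (Suc i)" 0
    by (rule braid_monoid_perm)
  show "P.word w = perm w"
    unfolding P.word_def by (induction w) (simp_all add: self_maps_def)
qed

lemma inj_on_canonical_snoc:
  "inj_on (\<lambda>(v, i). v @ rev [i..<Suc m]) (canonical m \<times> {1..Suc m})"
  using inj_on_perm_canonical_snoc[of m] bij_betw_perm_canonical[of m]
  by (intro inj_on_imageI2[of perm]) (auto simp: bij_betw_def o_def)

context braid_monoid
begin

lemma word_rev_upt_snoc:
  assumes "1 \<le> i" "m \<le> N" "j < m" "j \<noteq> i" "Suc j \<noteq> i"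
  shows "word (rev [i..<m] @ [j]) = word ((if j < i then j else j - 1) # rev [i..<m])"
proof (cases "j < i")
  case True
  then have "g j \<otimes> U i m = U i m \<otimes> g j"
    using assms by (intro commute_U) (auto intro: gen_commute)
  then show ?thesis
    using True by (simp add: word_append word_Cons U_def)
next
  case False
  then obtain l where "j = Suc l" "i \<le> l"
    using assms by (cases j) auto
  then show ?thesis
    using assms U_shift[of i l m] by (simp add: word_append word_Cons U_def)
qed

text \<open>
  Induction on \<open>m\<close>. For \<open>w = v @ rev [i..<Suc m]\<close> the new letter \<open>j\<close> either extends the last factor
  (\<open>j + 1 = i\<close>), or cancels its last letter in the permutation (\<open>j = i\<close>), or moves past it by braid
  relations, becoming a letter behind \<open>v\<close>. A cancellation changes the braid,
  but it makes the word shorter.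
\<close>

lemma canonical_snoc:
  assumes "w \<in> canonical m" "1 \<le> j" "j < m" "m \<le> N"
  shows "\<exists>w'\<in>canonical m. perm w' = perm (w @ [j]) \<and>
    (length w' = Suc (length w) \<and> word w' = word (w @ [j]) \<or> length w' < length w)"
  using assms
proof (induction m arbitrary: w j)
  case (Suc m)
  let ?u = "\<lambda>i. rev [i..<Suc m]"
  obtain v i where v: "v \<in> canonical m" "1 \<le> i" "i \<le> Suc m" "w = v @ ?u i"
    using Suc.prems by (elim canonicalE)
  consider "Suc j = i" | "j = i" | "j \<noteq> i" "Suc j \<noteq> i" by blast
  then show ?case
  proof cases
    case 1
    then have "?u j = ?u i @ [j]"
      using v by (simp add: upt_conv_Cons del: upt_Suc)
    then have "v @ ?u j = w @ [j]"
      using v by simp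
    moreover have "v @ ?u j \<in> canonical (Suc m)"
      using v 1 Suc.prems by (intro canonicalI) auto
    ultimately show ?thesis
      by (intro bexI[of _ "v @ ?u j"]) auto
  next
    case 2
    then have "w = v @ ?u (Suc j) @ [j]"
      using v Suc.prems by (simp add: upt_conv_Cons del: upt_Suc)
    then have "perm (v @ ?u (Suc j)) = perm (w @ [j])" "length (v @ ?u (Suc j)) < length w"
      by (simp_all add: fun_eq_iff del: upt_Suc)
    moreover have "v @ ?u (Suc j) \<in> canonical (Suc m)"
      using v 2 Suc.prems by (intro canonicalI) auto
    ultimately show ?thesis
      by blast
  next
    case 3
    \<comment> \<open>The letter that \<open>j\<close> turns into when it moves past the last factor.\<close>
    define l where "l = (if j < i then j else j - 1)"
    have l: "1 \<le> l" "l < m"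
      using v 3 Suc.prems by (auto simp: l_def)
    interpret P: braid_monoid "self_maps"
        "\<lambda>i. Transposition.transpose i (Suc i)" "Suc m"
      by (rule braid_monoid_perm)
    have word: "word (?u i @ [j]) = word (l # ?u i)"
      unfolding l_def using v 3 Suc.prems by (intro word_rev_upt_snoc) auto
    have "P.word (?u i @ [j]) = P.word (l # ?u i)"
      unfolding l_def using v 3 Suc.prems by (intro P.word_rev_upt_snoc) auto
    then have perm: "perm (?u i @ [j]) = perm (l # ?u i)"
      by (simp only: word_perm)
    obtain v' where v': "v' \<in> canonical m" "perm v' = perm (v @ [l])"
      "length v' = Suc (length v) \<and> word v' = word (v @ [l]) \<or> length v' < length v"
      using Suc.IH[OF v(1) l] Suc.prems(4) by (meson Suc_leD)
    have "perm (v' @ ?u i) = perm v \<circ> perm (l # ?u i)"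
      by (simp add: v'(2) o_assoc del: upt_Suc)
    also have "\<dots> = perm (w @ [j])"
      unfolding perm[symmetric] by (simp add: v(4) o_assoc del: upt_Suc)
    finally have "perm (v' @ ?u i) = perm (w @ [j])" .
    moreover have "word (v' @ ?u i) = word (w @ [j])" if "word v' = word (v @ [l])"
    proof -
      have "word (v' @ ?u i) = word v \<otimes> word (l # ?u i)"
        by (simp add: word_append word_Cons that m_assoc del: upt_Suc)
      also have "\<dots> = word (w @ [j])"
        unfolding word[symmetric] by (simp add: v(4) word_append m_assoc del: upt_Suc)
      finally show ?thesis .
    qed
    moreover have "v' @ ?u i \<in> canonical (Suc m)"
      using v v' by (intro canonicalI) auto
    ultimately show ?thesis
      using v'(3) v(4) by (intro bexI[of _ "v' @ ?u i"]) (auto simp del: upt_Suc)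
  qed
qed simp

lemma Nil_canonical: "[] \<in> canonical m"
proof (induction m)
  case (Suc m)
  then show ?case
    using canonicalI[of "[]" m "Suc m"] by simp
qed simp

text \<open>
  The word is read from the left and kept canonical; as soon as a letter cancels, the
  result is strictly shorter than the original word.
\<close>

lemma canonical_form:
  assumes "js \<in> lists {1..<m}" "m \<le> N"
  shows "\<exists>w\<in>canonical m. perm w = perm js \<and>
    (length w = length js \<and> word w = word js \<or> length w < length js)"
  using assms(1)
proof (induction js rule: rev_induct)
  case Nil
  then show ?case using Nil_canonical by (intro bexI[of _ "[]"]) auto
next
  case (snoc j js)
  then obtain w where w: "w \<in> canonical m" "perm w = perm js"
    "length w = length js \<and> word w = word js \<or> length w < length js"
    by auto
  obtain w' where w': "w' \<in> canonical m" "perm w' = perm (w @ [j])"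
    "length w' = Suc (length w) \<and> word w' = word (w @ [j]) \<or> length w' < length w"
    using canonical_snoc[OF w(1), of j] snoc.prems assms(2) by auto
  show ?case
    using w w' by (intro bexI[of _ w']) (auto simp: word_append)
qed

end

lemma reduced_expression_iff:
  "reduced_expression m js x \<longleftrightarrow> js \<in> lists {1..<m} \<and> perm js = x \<and>
     (\<forall>ks\<in>lists {1..<m}. perm ks = x \<longrightarrow> length js \<le> length ks)"
  by (simp add: reduced_expression_def list_prod_sym_group)

text \<open>
  A reduced word cannot become shorter in \<open>canonical_form\<close>, so it equals a canonical word in the
  monoid, and its permutation determines which one.
\<close>

lemma (in braid_monoid) matsumoto:
  assumes "w \<in> canonical m" "m \<le> N" "reduced_expression m js (perm w)"
  shows "word js = word w"
proof -
  have js: "js \<in> lists {1..<m}" "perm js = perm w"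
    "\<And>ks. ks \<in> lists {1..<m} \<Longrightarrow> perm ks = perm w \<Longrightarrow> length js \<le> length ks"
    using assms(3) unfolding reduced_expression_iff by blast+
  obtain v where v: "v \<in> canonical m" "perm v = perm js"
    "length v = length js \<and> word v = word js \<or> length v < length js"
    using canonical_form[OF js(1) assms(2)] by blast
  have "v = w"
    using bij_betw_perm_canonical[of m] v js assms by (auto simp: bij_betw_def inj_on_def)
  moreover have "length js \<le> length v"
    using v js canonical_lists by (intro js(3)) auto
  ultimately show ?thesis
    using v by auto
qed

lemma reduced_expression_exists:
  assumes "js \<in> lists {1..<m}"
  shows "\<exists>ks. reduced_expression m ks (perm js)"
proof -
  obtain ks where "ks \<in> lists {1..<m} \<and> perm ks = perm js"
    "\<forall>ls. ls \<in> lists {1..<m} \<and> perm ls = perm js \<longrightarrow> length ks \<le> length ls"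
    using ex_has_least_nat[of "\<lambda>ks. ks \<in> lists {1..<m} \<and> perm ks = perm js" js length] assms
    by blast
  then show ?thesis
    unfolding reduced_expression_iff by blast
qed

section \<open>The symmetrizer\<close>

text \<open>
  The continuation by the unit that the locale \<open>braid_monoid\<close> asks for.
\<close>

definition padded_gen :: "nat \<Rightarrow> nat \<Rightarrow> braid" where
  "padded_gen n i = (if i \<in> {1..<n} then braid_gen n i else \<one>\<^bsub>braid_group n\<^esub>)"

lemma braid_monoid_braid_group: "braid_monoid (braid_group n) (padded_gen n) n"
proof -
  interpret group "braid_group n" by (rule group_braid_group)
  have w: "[(i, True)] \<in> braid_words n" if "i \<in> {1..<n}" for i
    using that by (simp add: braid_words_def)
  show ?thesis
  proof
    show closed: "padded_gen n i \<in> carrier (braid_group n)" for i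
      by (simp add: padded_gen_def braid_gen_closed)
    show "padded_gen n i \<otimes>\<^bsub>braid_group n\<^esub> padded_gen n j
        = padded_gen n j \<otimes>\<^bsub>braid_group n\<^esub> padded_gen n i"
      if ij: "Suc i < j" for i j
    proof (cases "i \<in> {1..<n} \<and> j \<in> {1..<n}")
      case True
      then have "braid_eq n [(i, True), (j, True)] [(j, True), (i, True)]"
        using ij by (intro braid_eq.commute) auto
      with True show ?thesis
        unfolding padded_gen_def braid_gen_def
        by (simp add: braid_class_mult w braid_class_eq_iff braid_words_def)
    next
      case False
      then have "padded_gen n i = \<one>\<^bsub>braid_group n\<^esub> \<or> padded_gen n j = \<one>\<^bsub>braid_group n\<^esub>"
        by (auto simp: padded_gen_def)
      then show ?thesis using closed by auto
    qed
    show "padded_gen n i \<otimes>\<^bsub>braid_group n\<^esub> padded_gen n (Suc i) \<otimes>\<^bsub>braid_group n\<^esub> padded_gen n i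
        = padded_gen n (Suc i) \<otimes>\<^bsub>braid_group n\<^esub> padded_gen n i \<otimes>\<^bsub>braid_group n\<^esub> padded_gen n (Suc i)"
      if "1 \<le> i" "Suc i < n" for i
      using that braid_eq.braid[of i n] unfolding padded_gen_def braid_gen_def
      by (simp add: braid_class_mult braid_class_eq_iff braid_words_def)
  qed
qed

lemma group_elt_mult:
  "group_elt a \<otimes>\<^bsub>group_algebra G\<^esub> group_elt b = group_elt (a \<otimes>\<^bsub>G\<^esub> b)"
  by (simp add: group_elt_def group_algebra_mult_single)

lemma group_elt_one: "group_elt \<one>\<^bsub>G\<^esub> = \<one>\<^bsub>group_algebra G\<^esub>"
  by (simp add: group_elt_def group_algebra_def)

lemma group_elt_closed:
  "a \<in> carrier G \<Longrightarrow> (group_elt a :: 'g \<Rightarrow>\<^sub>0 'k::field) \<in> carrier (group_algebra G)"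
  by (simp add: group_elt_def group_algebra_def)

lemma group_elt_list_prod:
  "group_elt (list_prod G xs) = list_prod (group_algebra G) (map group_elt xs)"
  by (induction xs) (simp_all add: group_elt_one group_elt_mult[symmetric])

lemma (in braid_monoid) braid_ring_group_algebra:
  assumes "group G"
  shows "braid_ring (group_algebra G :: ('a \<Rightarrow>\<^sub>0 'k::field) ring) (\<lambda>i. group_elt (g i)) N"
proof -
  interpret A: ring "group_algebra G :: ('a \<Rightarrow>\<^sub>0 'k) ring"
    by (rule ring_group_algebra) fact
  have "(group_elt (g i \<otimes> g j) :: 'a \<Rightarrow>\<^sub>0 'k) = group_elt (g j \<otimes> g i)" if "Suc i < j" for i j
    using gen_commute[OF that] by simp
  then show ?thesis
    by unfold_locales (simp_all add: group_elt_closed group_elt_mult gen_braid)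
qed

lemma finsum_group_algebra:
  fixes f :: "'i \<Rightarrow> 'g \<Rightarrow>\<^sub>0 'k::field"
  assumes "group G" "finite A" "f \<in> A \<rightarrow> carrier (group_algebra G)"
  shows "finsum (group_algebra G) f A = (\<Sum>a\<in>A. f a)"
proof -
  interpret ring "group_algebra G :: ('g \<Rightarrow>\<^sub>0 'k) ring"
    by (rule ring_group_algebra) fact
  have zero: "\<zero>\<^bsub>group_algebra G\<^esub> = 0"
    and add: "a \<oplus>\<^bsub>group_algebra G\<^esub> b = a + b" for a b :: "'g \<Rightarrow>\<^sub>0 'k"
    by (simp_all add: group_algebra_def)
  show ?thesis
    using assms(2,3) by (induction A) (auto simp: zero add)
qed

lemma (in abelian_monoid) finsum_Times:
  assumes "finite A" "finite B" "\<And>a b. a \<in> A \<Longrightarrow> b \<in> B \<Longrightarrow> f (a, b) \<in> carrier G"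
  shows "finsum G f (A \<times> B) = (\<Oplus>a\<in>A. \<Oplus>b\<in>B. f (a, b))"
  using assms(1,3)
proof (induction A)
  case (insert a A)
  have "finsum G f (insert a A \<times> B) = finsum G f (Pair a ` B \<union> A \<times> B)"
    by (rule arg_cong[of _ _ "finsum G f"]) auto
  also have "\<dots> = finsum G f (Pair a ` B) \<oplus> finsum G f (A \<times> B)"
    using insert assms(2) by (intro finsum_Un_disjoint) auto
  also have "finsum G f (Pair a ` B) = (\<Oplus>b\<in>B. f (a, b))"
    using insert by (intro finsum_reindex) (auto simp: inj_on_def)
  finally show ?case
    using insert by (subst finsum_insert) auto
qed simp

text \<open>
  Multiplying out \<open>symm\<close>, the choice of a summand of the factor \<open>sum_U 1 j\<close> is the choice of the last
  factor of a word in \<open>canonical j\<close>.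
\<close>

lemma (in braid_ring) symm_eq_finsum_canonical:
  "symm 1 m = (\<Oplus>w\<in>canonical m. word w)"
proof (induction m)
  case 0
  show ?case by (simp add: symm_empty)
next
  case (Suc m)
  let ?u = "\<lambda>i. rev [i..<Suc m]"
  have sum_U: "sum_U 1 (Suc m) = (\<Oplus>i\<in>{1..Suc m}. word (?u i))"
    by (simp add: sum_U_def U_def)
  have "symm 1 (Suc m) = (\<Oplus>v\<in>canonical m. word v) \<otimes> sum_U 1 (Suc m)"
    by (simp add: symm_upper flip: Suc)
  also have "\<dots> = (\<Oplus>v\<in>canonical m. word v \<otimes> sum_U 1 (Suc m))"
    by (rule finsum_ldistr) auto
  also have "\<dots> = (\<Oplus>v\<in>canonical m. \<Oplus>i\<in>{1..Suc m}. word (v @ ?u i))"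
    unfolding sum_U by (intro finsum_cong') (auto simp: word_append finsum_rdistr simp del: upt_Suc)
  also have "\<dots> = (\<Oplus>a\<in>canonical m \<times> {1..Suc m}. word ((\<lambda>(v, i). v @ ?u i) a))"
    by (subst finsum_Times) auto
  also have "\<dots> = (\<Oplus>w\<in>canonical (Suc m). word w)"
    unfolding canonical.simps
    by (subst finsum_reindex[OF _ inj_on_canonical_snoc])
      (auto simp: case_prod_beta simp del: upt_Suc)
  finally show ?case .
qed

lemma braid_section_canonical:
  assumes "w \<in> canonical n"
  shows "braid_section n (perm w) = list_prod (braid_group n) (map (braid_gen n) w)"
proof -
  interpret braid_monoid "braid_group n" "padded_gen n" n by (rule braid_monoid_braid_group)
  have word: "list_prod (braid_group n) (map (braid_gen n) js) = word js"
    if "js \<in> lists {1..<n}" for js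
    using that unfolding word_def
    by (intro arg_cong[where f = "list_prod _"]) (auto simp: padded_gen_def)
  have w: "w \<in> lists {1..<n}" using assms canonical_lists by blast
  have reduced: "list_prod (braid_group n) (map (braid_gen n) js) = word w"
    if "reduced_expression n js (perm w)" for js
    using matsumoto[OF assms _ that] that word[of js] by (auto simp: reduced_expression_iff)
  obtain ks where "reduced_expression n ks (perm w)"
    using reduced_expression_exists[OF w] by blast
  then show ?thesis
    unfolding braid_section_def word[OF w]
    using reduced by (intro the_equality) metis+
qed

lemma braid_gens_closed:
  assumes "set w \<subseteq> {1..<n}"
  shows "list_prod (braid_group n) (map (braid_gen n) w) \<in> carrier (braid_group n)"
proof -
  interpret group "braid_group n" by (rule group_braid_group)
  show ?thesis
    by (rule list_prod_closed) (auto intro: braid_gen_closed[OF subsetD[OF assms]])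
qed

lemma symmetrizer_eq_sum:
  "symmetrizer n = (\<Sum>w\<in>canonical n.
     group_elt (list_prod (braid_group n) (map (braid_gen n) w)) :: braid \<Rightarrow>\<^sub>0 'k::field)"
proof -
  interpret braid_monoid "braid_group n" "padded_gen n" n by (rule braid_monoid_braid_group)
  have bij: "bij_betw perm (canonical n) (carrier (sym_group n))"
    using bij_betw_perm_canonical by (simp add: sym_group_def)
  have closed: "group_elt (braid_section n x) \<in> carrier (braid_algebra n)"
    if x: "x \<in> carrier (sym_group n)" for x
  proof -
    obtain w where w: "w \<in> canonical n" "x = perm w"
      using x unfolding bij_betw_imp_surj_on[OF bij, symmetric] by blast
    then have "set w \<subseteq> {1..<n}"
      using canonical_lists by blast
    then have "list_prod (braid_group n) (map (braid_gen n) w) \<in> carrier (braid_group n)"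
      by (rule braid_gens_closed)
    then show ?thesis
      using w by (simp add: braid_section_canonical group_elt_closed)
  qed
  have "symmetrizer n = (\<Sum>x\<in>carrier (sym_group n). group_elt (braid_section n x) :: braid \<Rightarrow>\<^sub>0 'k)"
    unfolding symmetrizer_def using bij closed bij_betw_finite[OF bij]
    by (intro finsum_group_algebra group_braid_group) auto
  also have "\<dots> = (\<Sum>w\<in>canonical n. group_elt (braid_section n (perm w)))"
    by (rule sum.reindex_bij_betw[OF bij, symmetric])
  finally show ?thesis
    by (simp add: braid_section_canonical)
qed

lemma group_algebra_map_add:
  "group_algebra_map \<phi> (f + g) = group_algebra_map \<phi> f + group_algebra_map \<phi> g"
proof -
  let ?A = "Poly_Mapping.keys f \<union> Poly_Mapping.keys g"
  show ?thesis
    using Poly_Mapping.keys_add[of f g]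
    by (simp add: group_algebra_map_superset[of ?A] lookup_add single_add sum.distrib)
qed

lemma group_algebra_map_sum:
  "group_algebra_map \<phi> (\<Sum>a\<in>A. f a) = (\<Sum>a\<in>A. group_algebra_map \<phi> (f a))"
proof (induction A rule: infinite_finite_induct)
  case (insert a A)
  then show ?case by (simp add: group_algebra_map_add)
qed (simp_all add: group_algebra_map_def)

lemma braid_incl_list_prod:
  assumes "set w \<subseteq> {1..<n}"
  shows "braid_incl n (list_prod (braid_group n) (map (braid_gen n) w))
    = list_prod (braid_group (Suc n)) (map (braid_gen (Suc n)) w)"
  using assms
proof (induction w)
  case Nil
  show ?case
    by (simp add: braid_group_def braid_incl_class braid_nil_words)
next
  case (Cons i w)
  then have "i \<in> {1..<n}" "set w \<subseteq> {1..<n}"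
    by auto
  then show ?case
    using Cons.IH braid_gens_closed[of w n] braid_gen_closed[of i n] braid_incl_gen[of i n]
      hom_mult[OF braid_incl_hom[of n]] by simp
qed

lemma symmetrizer_incl_eq_sum:
  "symmetrizer_incl n = (\<Sum>w\<in>canonical n.
     group_elt (list_prod (braid_group (Suc n)) (map (braid_gen (Suc n)) w)) :: braid \<Rightarrow>\<^sub>0 'k::field)"
  unfolding symmetrizer_incl_def symmetrizer_eq_sum group_algebra_map_sum
  using canonical_lists[of n] by (intro sum.cong) (auto simp: braid_incl_list_prod subset_iff)

section \<open>The identity\<close>

text \<open>
  Both sides are \<open>(a b)\<^sup>3 = (b a)\<^sup>3\<close>, the square of \<open>a b a\<close>. With \<open>a = \<sigma>\<^sub>n\<close> and \<open>b = \<sigma>\<^sub>n\<^sub>-\<^sub>1\<close> this is the type B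
  relation for \<open>a\<^sup>2\<close>; the sign in \<open>y = - a\<^sup>2\<close> cancels, as \<open>y\<close> occurs twice on each side.
\<close>

lemma (in monoid) braid_relation_square:
  assumes "a \<in> carrier G" "b \<in> carrier G" and "a \<otimes> b \<otimes> a = b \<otimes> a \<otimes> b"
  shows "b \<otimes> (a \<otimes> a) \<otimes> b \<otimes> (a \<otimes> a) = a \<otimes> a \<otimes> b \<otimes> (a \<otimes> a) \<otimes> b"
proof -
  have "b \<otimes> (a \<otimes> a) \<otimes> b \<otimes> (a \<otimes> a) = b \<otimes> a \<otimes> (a \<otimes> b \<otimes> a) \<otimes> a"
    using assms(1,2) by (simp add: m_assoc)
  also have "\<dots> = b \<otimes> a \<otimes> (b \<otimes> a \<otimes> b) \<otimes> a"
    by (simp only: assms(3))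
  also have "\<dots> = (b \<otimes> a \<otimes> b) \<otimes> (a \<otimes> b \<otimes> a)"
    using assms(1,2) by (simp add: m_assoc)
  also have "\<dots> = (a \<otimes> b \<otimes> a) \<otimes> (b \<otimes> a \<otimes> b)"
    unfolding assms(3) ..
  also have "\<dots> = a \<otimes> (b \<otimes> a \<otimes> b) \<otimes> a \<otimes> b"
    using assms(1,2) by (simp add: m_assoc)
  also have "\<dots> = a \<otimes> a \<otimes> b \<otimes> (a \<otimes> a) \<otimes> b"
    unfolding assms(3)[symmetric] using assms(1,2) by (simp add: m_assoc)
  finally show ?thesis .
qed

text \<open>
  Splitting off the last strand and telescoping turns the left hand side into \<open>symm 1 n\<close> times the
  type B product for \<open>y = \<ominus> (g n \<otimes> g n)\<close>. The choice of sign absorbs all signs of the identity.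
\<close>

lemma (in braid_ring) symmetrizer_identity:
  assumes "1 \<le> n" "Suc n \<le> N"
  shows "symm 1 (Suc n) \<otimes> list_prod R (map (\<lambda>i. \<one> \<ominus> U i (Suc n)) [1..<Suc n])
    = list_prod R (map (\<lambda>i. \<one> \<ominus> D i (Suc n) \<otimes> g n) (rev [1..<Suc n])) \<otimes> symm 1 n"
proof -
  let ?y = "\<ominus> (g n \<otimes> g n)"
  interpret type_B R g N n ?y
  proof
    show "?y \<otimes> g i = g i \<otimes> ?y" if "1 \<le> i" "Suc i < n" for i
    proof -
      have c: "g n \<otimes> g i = g i \<otimes> g n"
        using gen_commute[of i n] that by simp
      have "g n \<otimes> g n \<otimes> g i = g n \<otimes> (g i \<otimes> g n)"
        by (simp add: m_assoc c)
      also have "\<dots> = g i \<otimes> (g n \<otimes> g n)"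
        by (simp add: c flip: m_assoc)
      finally show ?thesis
        by (simp add: l_minus r_minus)
    qed
    show "g i \<otimes> ?y \<otimes> g i \<otimes> ?y = ?y \<otimes> g i \<otimes> ?y \<otimes> g i" if "1 \<le> i" "Suc i = n" for i
      using braid_relation_square[of "g n" "g i"] gen_braid[of i] that assms
      by (simp add: l_minus r_minus)
  qed (use assms in auto)
  have "symm 1 (Suc n) \<otimes> list_prod R (map (\<lambda>i. \<one> \<ominus> U i (Suc n)) [1..<Suc n])
      = symm 1 n \<otimes> (sum_U 1 (Suc n) \<otimes> list_prod R (map (\<lambda>i. \<one> \<ominus> U i (Suc n)) [1..<Suc n]))"
    by (subst symm_upper) (auto intro!: m_assoc list_prod_closed)
  also have "sum_U 1 (Suc n) \<otimes> list_prod R (map (\<lambda>i. \<one> \<ominus> U i (Suc n)) [1..<Suc n])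
      = list_prod R (map (\<lambda>i. \<one> \<oplus> ?y \<otimes> U i n) [1..<Suc n])"
    using assms
    by (subst sum_U_telescope)
      (auto intro!: arg_cong[where f = "list_prod R"]
        simp: U_Cons minus_eq l_minus m_assoc simp del: upt_Suc)
  also have "symm 1 n \<otimes> \<dots> = list_prod R (map (\<lambda>i. \<one> \<oplus> D i n \<otimes> ?y) (rev [1..<Suc n])) \<otimes> symm 1 n"
    by (rule symm_prod_B_exchange) fact
  also have "map (\<lambda>i. \<one> \<oplus> D i n \<otimes> ?y) (rev [1..<Suc n])
      = map (\<lambda>i. \<one> \<ominus> D i (Suc n) \<otimes> g n) (rev [1..<Suc n])"
    by (auto simp: D_snoc minus_eq r_minus m_assoc simp del: upt_Suc)
  finally show ?thesis .
qed

theorem proposition2p2: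
  fixes n :: nat
  assumes "n \<ge> 1"
  shows "symmetrizer (Suc n) \<otimes>\<^bsub>braid_algebra (Suc n)\<^esub>
           list_prod (braid_algebra (Suc n)) (map (\<lambda>i. one_minus (Suc n) (braid_U n i)) [1..<Suc n])
         = braid_R n 1 \<otimes>\<^bsub>braid_algebra (Suc n)\<^esub>
             (symmetrizer_incl n :: braid \<Rightarrow>\<^sub>0 'k :: {alg_closed_field, field_char_0})"
proof -
  let ?B = "braid_group (Suc n)" and ?A = "braid_algebra (Suc n) :: (braid \<Rightarrow>\<^sub>0 'k) ring"
  define s where "s i = (group_elt (padded_gen (Suc n) i) :: braid \<Rightarrow>\<^sub>0 'k)" for i
  interpret braid_ring ?A s "Suc n"
    unfolding s_def
    by (intro braid_monoid.braid_ring_group_algebra braid_monoid_braid_group group_braid_group)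
  have elt_word: "group_elt (list_prod ?B (map (braid_gen (Suc n)) w)) = word w"
    if "w \<in> lists {1..<Suc n}" for w
  proof -
    have "map (braid_gen (Suc n)) w = map (padded_gen (Suc n)) w"
      using that by (auto simp: padded_gen_def)
    then have "group_elt (list_prod ?B (map (braid_gen (Suc n)) w))
        = list_prod ?A (map group_elt (map (padded_gen (Suc n)) w))"
      by (simp only: group_elt_list_prod)
    also have "map group_elt (map (padded_gen (Suc n)) w) = map s w"
      by (simp add: s_def)
    finally show ?thesis
      by (simp only: word_def)
  qed
  have sum_words: "(\<Sum>w\<in>canonical m. group_elt (list_prod ?B (map (braid_gen (Suc n)) w))) = symm 1 m"
    if "m \<le> Suc n" for m
  proof -
    have "canonical m \<subseteq> lists {1..<Suc n}"
      using that by (intro order_trans[OF canonical_lists] lists_mono) auto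
    then have "(\<Sum>w\<in>canonical m. group_elt (list_prod ?B (map (braid_gen (Suc n)) w)))
        = (\<Sum>w\<in>canonical m. word w)"
      by (intro sum.cong refl elt_word) auto
    also have "\<dots> = symm 1 m"
      unfolding symm_eq_finsum_canonical
      by (rule finsum_group_algebra[symmetric]) (auto intro: group_braid_group)
    finally show ?thesis .
  qed
  have U: "group_elt (braid_U n i) = U i (Suc n)" if "1 \<le> i" for i
    unfolding braid_U_def U_def using that by (intro elt_word) auto
  have D: "group_elt (braid_D n i) = D i (Suc n)" if "1 \<le> i" for i
    unfolding braid_D_def D_def using that by (intro elt_word) auto
  have elt_gen: "group_elt (braid_gen (Suc n) n) = s n"
    using assms by (simp add: s_def padded_gen_def)
  have "braid_R n 1 = list_prod ?A (map (\<lambda>i. \<one>\<^bsub>?A\<^esub> \<ominus>\<^bsub>?A\<^esub> D i (Suc n) \<otimes>\<^bsub>?A\<^esub> s n) (rev [1..<Suc n]))"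
  proof -
    have upt: "rev [1..<Suc n] = n # rev [1..<n]" using assms by simp
    have D_n: "D n (Suc n) = s n" by (simp add: D_snoc)
    have map: "map (\<lambda>k. one_minus (Suc n) (braid_D n k \<otimes>\<^bsub>?B\<^esub> braid_gen (Suc n) n)) (rev [1..<n])
        = map (\<lambda>i. \<one>\<^bsub>?A\<^esub> \<ominus>\<^bsub>?A\<^esub> D i (Suc n) \<otimes>\<^bsub>?A\<^esub> s n) (rev [1..<n])"
      by (auto simp: one_minus_def group_elt_mult[symmetric] D elt_gen)
    show ?thesis
      unfolding braid_R_def map upt list.map list_prod_Cons D_n
      by (simp only: one_minus_def group_elt_mult[symmetric] elt_gen)
  qed
  moreover have "map (\<lambda>i. one_minus (Suc n) (braid_U n i)) [1..<Suc n]
      = map (\<lambda>i. \<one>\<^bsub>?A\<^esub> \<ominus>\<^bsub>?A\<^esub> U i (Suc n)) [1..<Suc n]"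
    by (auto simp: one_minus_def U simp del: upt_Suc)
  moreover have "symmetrizer (Suc n) = symm 1 (Suc n)" "symmetrizer_incl n = symm 1 n"
    by (simp_all only: symmetrizer_eq_sum symmetrizer_incl_eq_sum sum_words
        le_Suc_eq order_refl simp_thms)
  ultimately show ?thesis
    using symmetrizer_identity[OF assms order_refl] by (simp only:)
qed

end
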